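(* Let $I\times_fM^n$ be a warped product such that $\mathcal{H}(t)\geq1$ for all $t\in I$. Let $\Sigma^n$ be a complete non-compact helix-type hypersurface contained in a slab of $I\times_fM^n$ with polynomial volume growth. If the mean curvature $H$ of $\Sigma^n$ (not necessarily constant) satisfies $H^2\leq1$, then $\Sigma^n$ is a slice.
   Context: Let $(M^n,\langle\cdot,\cdot\rangle_M)$ be a connected oriented $n$-dimensional Riemannian manifold, $n\geq2$, $I\subset\mathbb{R}$ an interval, and $f:I\to\mathbb{R}$ a positive smooth function. The warped product $I\times_fM^n$ is the product manifold $I\times M^n$ with the metric $dt^2+f(t)^2\langle\cdot,\cdot\rangle_M$. Put $\mathcal{H}(t)=f'(t)/f(t)$ and let $\partial_t$ be the unit coordinate vector field tangent to $I$. The slices are the hypersurfaces $M^n_t=\{t\}\times M^n$, $t\in I$. A hypersurface is given by an isometric immersion $x:\Sigma^n\to I\times_fM^n$ of a connected manifold $\Sigma^n$ (with the induced metric), with unit normal field $N$, shape operator $A(X)=-\overline{\nabla}_XN$ (where $\overline\nabla$ is the Levi-Civita connection of $I\times_fM^n$) and mean curvature $H=\frac1n\mathrm{tr}(A)$. It is contained in a slab if $x(\Sigma)\subset[t_1,t_2]\times M^n$ for some $[t_1,t_2]\subset I$ with $t_1<t_2$. It is of helix type if the angle function $\langle N,\partial_t\rangle$ is constant on $\Sigma^n$. "$\Sigma^n$ is a slice" means $x(\Sigma^n)=M^n_t$ for some $t\in I$. $\Sigma^n$ has polynomial volume growth if there exist a point $q\in\Sigma^n$ and positive numbers $a,c$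 such that $\mathrm{vol}(B_r(q))\leq c\,r^a$ for all sufficiently large $r$, where $B_r(q)$ is the geodesic ball of $\Sigma^n$ of radius $r$ centered at $q$. *)

theory Defs
  imports "HOL-Analysis.Analysis"
begin

section \<open>Differentiability classes\<close>

text \<open>
  All derivatives are taken within the set, so that on an interval with end points the
  derivatives there are one-sided. The notion is only used for open sets and for
  nondegenerate intervals, where the derivative within the set is unique.
\<close>

primrec Ck_on ::
  "nat \<Rightarrow> 'a::euclidean_space set \<Rightarrow> ('a \<Rightarrow> 'b::real_normed_vector) \<Rightarrow> bool" where
  "Ck_on 0 S f \<longleftrightarrow> continuous_on S f"
| "Ck_on (Suc k) S f \<longleftrightarrow> f differentiable_on S \<and>
     (\<forall>v. Ck_on k S (\<lambda>x. frechet_derivative f (at x within S) v))"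

definition smooth_on ::
  "'a::euclidean_space set \<Rightarrow> ('a \<Rightarrow> 'b::real_normed_vector) \<Rightarrow> bool" where
  "smooth_on S f \<longleftrightarrow> (\<forall>k. Ck_on k S f)"

section \<open>Riemannian manifolds\<close>

text \<open>
  A manifold with points in \<open>'a\<close>, modelled on \<open>'e\<close>, is given by an atlas indexed by the type
  \<open>'i\<close> (charts may be repeated or have empty domain, so indexing by a full type is no
  restriction). Its topology is the subspace topology of the union of the chart domains.
  A tangent vector at \<open>p\<close> is represented in the chart \<open>i\<close> by its components in \<open>'e\<close>; in
  particular \<open>chart_metric M i p\<close> is the inner product of the tangent space at \<open>p\<close> expressed
  in the components with respect to the chart \<open>i\<close>.
\<close>

record ('i, 'a, 'e) rmfd =
  chart_dom :: "'i \<Rightarrow> 'a set"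
  chart_map :: "'i \<Rightarrow> 'a \<Rightarrow> 'e"
  chart_metric :: "'i \<Rightarrow> 'a \<Rightarrow> 'e \<Rightarrow> 'e \<Rightarrow> real"

definition carrier :: "('i, 'a, 'e) rmfd \<Rightarrow> 'a set" where
  "carrier M = (\<Union>i. chart_dom M i)"

definition chart_img :: "('i, 'a, 'e) rmfd \<Rightarrow> 'i \<Rightarrow> 'e set" where
  "chart_img M i = chart_map M i ` chart_dom M i"

definition chart_inv :: "('i, 'a, 'e) rmfd \<Rightarrow> 'i \<Rightarrow> 'e \<Rightarrow> 'a" where
  "chart_inv M i = inv_into (chart_dom M i) (chart_map M i)"

definition chart_at :: "('i, 'a, 'e) rmfd \<Rightarrow> 'a \<Rightarrow> 'i" where
  "chart_at M p = (SOME i. p \<in> chart_dom M i)"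

text \<open>The change of components at \<open>p\<close> from the chart \<open>i\<close> to the chart \<open>j\<close>.\<close>

definition transition_deriv ::
  "('i, 'a, 'e::euclidean_space) rmfd \<Rightarrow> 'i \<Rightarrow> 'i \<Rightarrow> 'a \<Rightarrow> 'e \<Rightarrow> 'e" where
  "transition_deriv M i j p =
     frechet_derivative (chart_map M j \<circ> chart_inv M i)
       (at (chart_map M i p) within chart_map M i ` (chart_dom M i \<inter> chart_dom M j))"

definition smooth_manifold ::
  "('i, 'a::{t2_space, second_countable_topology}, 'e::euclidean_space) rmfd \<Rightarrow> bool" where
  "smooth_manifold M \<longleftrightarrow>
     (\<forall>i. openin (top_of_set (carrier M)) (chart_dom M i) \<and> open (chart_img M i) \<and>
        homeomorphism (chart_dom M i) (chart_img M i) (chart_map M i) (chart_inv M i)) \<and>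
     (\<forall>i j. smooth_on (chart_map M i ` (chart_dom M i \<inter> chart_dom M j))
        (chart_map M j \<circ> chart_inv M i))"

definition riemannian_manifold ::
  "('i, 'a::{t2_space, second_countable_topology}, 'e::euclidean_space) rmfd \<Rightarrow> bool" where
  "riemannian_manifold M \<longleftrightarrow> smooth_manifold M \<and>
     (\<forall>i. \<forall>p\<in>chart_dom M i.
        bilinear (chart_metric M i p) \<and>
        (\<forall>v w. chart_metric M i p v w = chart_metric M i p w v) \<and>
        (\<forall>v. v \<noteq> 0 \<longrightarrow> chart_metric M i p v v > 0)) \<and>
     (\<forall>i v w. smooth_on (chart_img M i) (\<lambda>u. chart_metric M i (chart_inv M i u) v w)) \<and>
     (\<forall>i j. \<forall>p\<in>chart_dom M i \<inter> chart_dom M j. \<forall>v w.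
        chart_metric M j p (transition_deriv M i j p v) (transition_deriv M i j p w) =
        chart_metric M i p v w)"

text \<open>The given atlas is an oriented one, and thus fixes an orientation.\<close>

definition oriented :: "('i, 'a, real^'n) rmfd \<Rightarrow> bool" where
  "oriented M \<longleftrightarrow> (\<forall>i j. \<forall>p\<in>chart_dom M i \<inter> chart_dom M j.
     det (matrix (transition_deriv M i j p)) > 0)"

section \<open>Riemannian distance and volume\<close>

definition piecewise_C1_curve ::
  "('i, 'a::topological_space, 'e::euclidean_space) rmfd \<Rightarrow> (real \<Rightarrow> 'a) \<Rightarrow> bool" where
  "piecewise_C1_curve M \<gamma> \<longleftrightarrow>
     continuous_on {0..1} \<gamma> \<and> \<gamma> ` {0..1} \<subseteq> carrier M \<and>
     (\<exists>T. finite T \<and>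
       (\<forall>i s t. 0 \<le> s \<and> s < t \<and> t \<le> 1 \<and> {s<..<t} \<inter> T = {} \<and> \<gamma> ` {s..t} \<subseteq> chart_dom M i
          \<longrightarrow> Ck_on 1 {s..t} (chart_map M i \<circ> \<gamma>)))"

definition speed :: "('i, 'a, 'e::euclidean_space) rmfd \<Rightarrow> (real \<Rightarrow> 'a) \<Rightarrow> real \<Rightarrow> real" where
  "speed M \<gamma> t =
     (let i = chart_at M (\<gamma> t); v = vector_derivative (chart_map M i \<circ> \<gamma>) (at t)
      in sqrt (chart_metric M i (\<gamma> t) v v))"

definition curve_length :: "('i, 'a, 'e::euclidean_space) rmfd \<Rightarrow> (real \<Rightarrow> 'a) \<Rightarrow> real" where
  "curve_length M \<gamma> = integral {0..1} (speed M \<gamma>)"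

text \<open>
  Used for connected manifolds only, where the set of lengths is nonempty. The value 0 off
  the carrier makes the function nonnegative everywhere, as \<open>Metric_space\<close> demands.
\<close>

definition riem_dist ::
  "('i, 'a::topological_space, 'e::euclidean_space) rmfd \<Rightarrow> 'a \<Rightarrow> 'a \<Rightarrow> real" where
  "riem_dist M p q =
     (if p \<in> carrier M \<and> q \<in> carrier M
      then Inf {curve_length M \<gamma> |\<gamma>. piecewise_C1_curve M \<gamma> \<and> \<gamma> 0 = p \<and> \<gamma> 1 = q}
      else 0)"

definition complete_riemannian ::
  "('i, 'a::topological_space, 'e::euclidean_space) rmfd \<Rightarrow> bool" where
  "complete_riemannian M \<longleftrightarrow> Metric_space.mcomplete (carrier M) (riem_dist M)"

definition geodesic_ball ::
  "('i, 'a::topological_space, 'e::euclidean_space) rmfd \<Rightarrow> 'a \<Rightarrow> real \<Rightarrow> 'a set" where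
  "geodesic_ball M = Metric_space.mball (carrier M) (riem_dist M)"

definition gram_matrix :: "('i, 'a, real^'n) rmfd \<Rightarrow> 'i \<Rightarrow> 'a \<Rightarrow> real^'n^'n" where
  "gram_matrix M i p = (\<chi> a b. chart_metric M i p (axis a 1) (axis b 1))"

text \<open>
  The Riemannian measure: the unique Borel measure which in every chart has the density
  \<open>sqrt (det g)\<close> with respect to Lebesgue measure.
\<close>

definition riem_volume :: "('i, 'a::topological_space, real^'n) rmfd \<Rightarrow> 'a measure" where
  "riem_volume M = (THE \<mu>.
     sets \<mu> = sets (restrict_space borel (carrier M)) \<and>
     (\<forall>i. \<forall>A\<in>sets \<mu>. A \<subseteq> chart_dom M i \<longrightarrow>
        emeasure \<mu> A =
        (\<integral>\<^sup>+u\<in>chart_map M i ` A. ennreal (sqrt (det (gram_matrix M i (chart_inv M i u)))) \<partial>lborel)))"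

definition polynomial_volume_growth ::
  "('i, 'a::topological_space, real^'n) rmfd \<Rightarrow> bool" where
  "polynomial_volume_growth M \<longleftrightarrow>
     (\<exists>q\<in>carrier M. \<exists>a>0. \<exists>c>0. eventually
        (\<lambda>r. emeasure (riem_volume M) (geodesic_ball M q r) \<le> ennreal (c * r powr a)) at_top)"

section \<open>Isometric immersions\<close>

definition smooth_map ::
  "('i, 'a::topological_space, 'e::euclidean_space) rmfd \<Rightarrow>
   ('j, 'b::topological_space, 'f::euclidean_space) rmfd \<Rightarrow> ('a \<Rightarrow> 'b) \<Rightarrow> bool" where
  "smooth_map S W x \<longleftrightarrow>
     x ` carrier S \<subseteq> carrier W \<and> continuous_on (carrier S) x \<and>
     (\<forall>i j. smooth_on (chart_map S i ` (chart_dom S i \<inter> x -` chart_dom W j))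
        (chart_map W j \<circ> x \<circ> chart_inv S i))"

text \<open>The differential of \<open>x\<close> at \<open>p\<close>, in components for the charts \<open>i\<close> and \<open>j\<close>.\<close>

definition differential ::
  "('i, 'a, 'e::euclidean_space) rmfd \<Rightarrow> ('j, 'b, 'f::euclidean_space) rmfd \<Rightarrow> ('a \<Rightarrow> 'b) \<Rightarrow>
   'i \<Rightarrow> 'j \<Rightarrow> 'a \<Rightarrow> 'e \<Rightarrow> 'f" where
  "differential S W x i j p =
     frechet_derivative (chart_map W j \<circ> x \<circ> chart_inv S i) (at (chart_map S i p))"

definition isometric_immersion ::
  "('i, 'a::topological_space, 'e::euclidean_space) rmfd \<Rightarrow>
   ('j, 'b::topological_space, 'f::euclidean_space) rmfd \<Rightarrow> ('a \<Rightarrow> 'b) \<Rightarrow> bool" where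
  "isometric_immersion S W x \<longleftrightarrow> smooth_map S W x \<and>
     (\<forall>i j. \<forall>p\<in>chart_dom S i \<inter> x -` chart_dom W j.
        inj (differential S W x i j p) \<and>
        (\<forall>v w. chart_metric S i p v w =
           chart_metric W j (x p) (differential S W x i j p v) (differential S W x i j p w)))"

text \<open>
  A smooth vector field along \<open>x\<close> with values in the tangent spaces of \<open>W\<close>: \<open>N j p\<close> are the
  components of its value at \<open>p\<close> with respect to the chart \<open>j\<close> of \<open>W\<close>.
\<close>

definition vector_field_along ::
  "('i, 'a::topological_space, 'e::euclidean_space) rmfd \<Rightarrow>
   ('j, 'b::topological_space, 'f::euclidean_space) rmfd \<Rightarrow> ('a \<Rightarrow> 'b) \<Rightarrow>
   ('j \<Rightarrow> 'a \<Rightarrow> 'f) \<Rightarrow> bool" where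
  "vector_field_along S W x N \<longleftrightarrow>
     (\<forall>j k. \<forall>p\<in>carrier S. x p \<in> chart_dom W j \<inter> chart_dom W k \<longrightarrow>
        N k p = transition_deriv W j k (x p) (N j p)) \<and>
     (\<forall>i j. smooth_on (chart_map S i ` (chart_dom S i \<inter> x -` chart_dom W j))
        (N j \<circ> chart_inv S i))"

definition unit_normal_field ::
  "('i, 'a::topological_space, 'e::euclidean_space) rmfd \<Rightarrow>
   ('j, 'b::topological_space, 'f::euclidean_space) rmfd \<Rightarrow> ('a \<Rightarrow> 'b) \<Rightarrow>
   ('j \<Rightarrow> 'a \<Rightarrow> 'f) \<Rightarrow> bool" where
  "unit_normal_field S W x N \<longleftrightarrow> vector_field_along S W x N \<and>
     (\<forall>i j. \<forall>p\<in>chart_dom S i \<inter> x -` chart_dom W j.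
        chart_metric W j (x p) (N j p) (N j p) = 1 \<and>
        (\<forall>v. chart_metric W j (x p) (N j p) (differential S W x i j p v) = 0))"

section \<open>Levi-Civita connection, shape operator and mean curvature\<close>

text \<open>
  \<open>metric_deriv W j p v w y\<close> is the derivative in direction \<open>v\<close> of the metric coefficient
  \<open>g(w,y)\<close> in the chart \<open>j\<close>, and \<open>christoffel W j p v w\<close> is the Levi-Civita derivative at \<open>p\<close>
  of the coordinate-constant field \<open>w\<close> in the direction \<open>v\<close>, i.e. the vector with components
  \<open>\<Gamma>\<^sup>k\<^sub>a\<^sub>b v\<^sup>a w\<^sup>b\<close>.
\<close>

definition metric_deriv ::
  "('j, 'b, 'f::euclidean_space) rmfd \<Rightarrow> 'j \<Rightarrow> 'b \<Rightarrow> 'f \<Rightarrow> 'f \<Rightarrow> 'f \<Rightarrow> real" where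
  "metric_deriv W j p v w y =
     frechet_derivative (\<lambda>u. chart_metric W j (chart_inv W j u) w y)
       (at (chart_map W j p) within chart_img W j) v"

definition christoffel ::
  "('j, 'b, 'f::euclidean_space) rmfd \<Rightarrow> 'j \<Rightarrow> 'b \<Rightarrow> 'f \<Rightarrow> 'f \<Rightarrow> 'f" where
  "christoffel W j p v w = (THE z. \<forall>y. chart_metric W j p z y =
     (metric_deriv W j p v w y + metric_deriv W j p w v y - metric_deriv W j p y v w) / 2)"

text \<open>The Levi-Civita derivative of a vector field \<open>N\<close> along \<open>x\<close> in the direction \<open>v\<close>.\<close>

definition cov_deriv_along ::
  "('i, 'a, 'e::euclidean_space) rmfd \<Rightarrow> ('j, 'b, 'f::euclidean_space) rmfd \<Rightarrow> ('a \<Rightarrow> 'b) \<Rightarrow>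
   ('j \<Rightarrow> 'a \<Rightarrow> 'f) \<Rightarrow> 'i \<Rightarrow> 'j \<Rightarrow> 'a \<Rightarrow> 'e \<Rightarrow> 'f" where
  "cov_deriv_along S W x N i j p v =
     frechet_derivative (N j \<circ> chart_inv S i) (at (chart_map S i p)) v +
     christoffel W j (x p) (differential S W x i j p v) (N j p)"

definition shape_operator ::
  "('i, 'a, 'e::euclidean_space) rmfd \<Rightarrow> ('j, 'b, 'f::euclidean_space) rmfd \<Rightarrow> ('a \<Rightarrow> 'b) \<Rightarrow>
   ('j \<Rightarrow> 'a \<Rightarrow> 'f) \<Rightarrow> 'i \<Rightarrow> 'j \<Rightarrow> 'a \<Rightarrow> 'e \<Rightarrow> 'e" where
  "shape_operator S W x N i j p v =
     (THE w. differential S W x i j p w = - cov_deriv_along S W x N i j p v)"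

definition mean_curvature ::
  "('i, 'a, real^'n) rmfd \<Rightarrow> ('j, 'b, 'f::euclidean_space) rmfd \<Rightarrow> ('a \<Rightarrow> 'b) \<Rightarrow>
   ('j \<Rightarrow> 'a \<Rightarrow> 'f) \<Rightarrow> 'a \<Rightarrow> real" where
  "mean_curvature S W x N p =
     trace (matrix (shape_operator S W x N (chart_at S p) (chart_at W (x p)) p)) / real CARD('n)"

section \<open>Warped products\<close>

text \<open>
  The chart \<open>i\<close> of \<open>M\<close> gives the chart \<open>id \<times> chart_map M i\<close> on \<open>I \<times> chart_dom M i\<close>. If \<open>I\<close> has
  end points, the result is a manifold with boundary; this is why derivatives above are taken
  within the chart images.
\<close>

definition warped_product ::
  "real set \<Rightarrow> (real \<Rightarrow> real) \<Rightarrow> ('i, 'm, 'e::euclidean_space) rmfd \<Rightarrow>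
   ('i, real \<times> 'm, real \<times> 'e) rmfd" where
  "warped_product I f M =
     \<lparr>chart_dom = (\<lambda>i. I \<times> chart_dom M i),
      chart_map = (\<lambda>i (t, q). (t, chart_map M i q)),
      chart_metric = (\<lambda>i (t, q) (a, v) (b, w). a * b + (f t)\<^sup>2 * chart_metric M i q v w)\<rparr>"

definition warp_H :: "real set \<Rightarrow> (real \<Rightarrow> real) \<Rightarrow> real \<Rightarrow> real" where
  "warp_H I f t = vector_derivative f (at t within I) / f t"

text \<open>In every chart of a warped product, the field \<open>\<partial>\<^sub>t\<close> has the components \<open>(1, 0)\<close>.\<close>

definition angle_function ::
  "('j, real \<times> 'm, real \<times> 'e::euclidean_space) rmfd \<Rightarrow> ('a \<Rightarrow> real \<times> 'm) \<Rightarrow>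
   ('j \<Rightarrow> 'a \<Rightarrow> real \<times> 'e) \<Rightarrow> 'a \<Rightarrow> real" where
  "angle_function W x N p =
     (let j = chart_at W (x p) in chart_metric W j (x p) (N j p) (1, 0))"

definition helix_type ::
  "('i, 'a, 'd) rmfd \<Rightarrow> ('j, real \<times> 'm, real \<times> 'e::euclidean_space) rmfd \<Rightarrow>
   ('a \<Rightarrow> real \<times> 'm) \<Rightarrow> ('j \<Rightarrow> 'a \<Rightarrow> real \<times> 'e) \<Rightarrow> bool" where
  "helix_type S W x N \<longleftrightarrow> angle_function W x N constant_on carrier S"

definition in_slab ::
  "('i, 'a, 'd) rmfd \<Rightarrow> real set \<Rightarrow> ('j, 'm, 'e) rmfd \<Rightarrow> ('a \<Rightarrow> real \<times> 'm) \<Rightarrow> bool" where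
  "in_slab S I M x \<longleftrightarrow>
     (\<exists>t1 t2. t1 < t2 \<and> {t1..t2} \<subseteq> I \<and> x ` carrier S \<subseteq> {t1..t2} \<times> carrier M)"

definition is_slice ::
  "('i, 'a, 'd) rmfd \<Rightarrow> real set \<Rightarrow> ('j, 'm, 'e) rmfd \<Rightarrow> ('a \<Rightarrow> real \<times> 'm) \<Rightarrow> bool" where
  "is_slice S I M x \<longleftrightarrow> (\<exists>t\<in>I. x ` carrier S = {t} \<times> carrier M)"

end

theory Submission
  imports Defs
begin

text \<open>
  The theorem is about the height function \<open>h\<close>, the first component of the immersion, and the
  angle \<open>\<Theta> = \<langle>N, \<partial>\<^sub>t\<rangle>\<close>. The tangential part of \<open>\<partial>\<^sub>t\<close> is the gradient of \<open>h\<close>, so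
  \<open>|\<nabla>h|\<^sup>2 = 1 - \<Theta>\<^sup>2\<close> (\<open>vertical_field_of_hypersurface\<close>), and for a helix-type hypersurface this
  is a constant.

  If \<open>\<Theta>\<^sup>2 < 1\<close>, then \<open>h\<close> increases at a fixed positive rate along its gradient, which is
  impossible for a bounded function on a complete manifold. Rather than following the gradient
  flow, the proof uses Ekeland's variational principle: on a complete Riemannian manifold, a
  function that is bounded below and lower semicontinuous has points at which no directional
  derivative is below \<open>-\<epsilon>\<close> times the length of the direction (\<open>almost_critical_point\<close>). Applied
  to \<open>-h\<close>, bounded because of the slab, with \<open>\<epsilon>\<close> below \<open>|\<nabla>h|\<close>, this is a contradiction.

  Hence \<open>\<Theta>\<^sup>2 = 1\<close>, so \<open>h\<close> is a constant \<open>t\<^sub>0\<close>. Then the second component of the immersion is a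
  map \<open>\<Sigma> \<rightarrow> M\<close> between manifolds of the same dimension which scales all lengths by \<open>1 / f(t\<^sub>0)\<close>, and
  what remains is that such a map from a complete manifold to a connected one is onto
  (\<open>complete_local_homothety_surj\<close>). This is again the variational principle, now applied to the
  distance from a given target point, measured in a chart of \<open>M\<close>: wherever that distance is
  positive, some direction decreases it at a definite rate, so its almost critical points are
  preimages of the target point.

  Completeness refers to the Riemannian distance, an infimum of lengths of curves. Most of the
  development shows that this distance is a metric (\<open>riem_dist_metric\<close>) and that sets open in the
  manifold are open for it (\<open>openin_metric_topology\<close>). Both rest on one estimate: in a compact
  chart ball the Riemannian norm dominates a multiple of the Euclidean one, so a curve leaving the
  ball has a length bounded below by a multiple of the radius (\<open>curve_length_escape\<close>).
\<close>

section \<open>Curves of class C1 in charts\<close>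

text \<open>
  On a nondegenerate interval the derivative within the interval is unique, so that the choice
  made by \<open>frechet_derivative\<close> can be replaced by any continuous velocity.
\<close>

lemma C1_interval_iff:
  fixes F :: "real \<Rightarrow> 'b::real_normed_vector"
  assumes "s < t"
  shows "Ck_on 1 {s..t} F \<longleftrightarrow>
    (\<exists>F'. continuous_on {s..t} F' \<and>
       (\<forall>\<tau>\<in>{s..t}. (F has_vector_derivative F' \<tau>) (at \<tau> within {s..t})))"
proof
  assume F: "Ck_on 1 {s..t} F"
  let ?D = "\<lambda>\<tau>. frechet_derivative F (at \<tau> within {s..t})"
  have cont: "continuous_on {s..t} (\<lambda>\<tau>. ?D \<tau> 1)"
    and diff: "F differentiable_on {s..t}"
    using F by (auto simp: One_nat_def)
  have "(F has_vector_derivative ?D \<tau> 1) (at \<tau> within {s..t})" if "\<tau> \<in> {s..t}" for \<tau>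
  proof -
    have D: "(F has_derivative ?D \<tau>) (at \<tau> within {s..t})"
      using diff that by (auto simp: differentiable_on_def frechet_derivative_works)
    have "?D \<tau> v = v *\<^sub>R ?D \<tau> 1" for v
      using linear_scale[OF has_derivative_linear[OF D], of v 1] by simp
    then have "?D \<tau> = (\<lambda>v. v *\<^sub>R ?D \<tau> 1)" by (rule ext)
    then show ?thesis
      using D unfolding has_vector_derivative_def by metis
  qed
  with cont show "\<exists>F'. continuous_on {s..t} F' \<and>
       (\<forall>\<tau>\<in>{s..t}. (F has_vector_derivative F' \<tau>) (at \<tau> within {s..t}))"
    by (intro exI[of _ "\<lambda>\<tau>. ?D \<tau> 1"]) auto
next
  assume "\<exists>F'. continuous_on {s..t} F' \<and>
       (\<forall>\<tau>\<in>{s..t}. (F has_vector_derivative F' \<tau>) (at \<tau> within {s..t}))"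
  then obtain F' where cont: "continuous_on {s..t} F'"
    and F': "\<And>\<tau>. \<tau> \<in> {s..t} \<Longrightarrow> (F has_vector_derivative F' \<tau>) (at \<tau> within {s..t})"
    by blast
  have diff: "F differentiable (at \<tau> within {s..t})" if "\<tau> \<in> {s..t}" for \<tau>
    using F'[OF that] by (rule differentiableI_vector)
  have "frechet_derivative F (at \<tau> within {s..t}) v = v *\<^sub>R F' \<tau>" if "\<tau> \<in> {s..t}" for \<tau> v
  proof -
    let ?D = "frechet_derivative F (at \<tau> within {s..t})"
    have D: "(F has_derivative ?D) (at \<tau> within {s..t})"
      using diff[OF that] by (simp add: frechet_derivative_works)
    have lin: "?D v = v *\<^sub>R ?D 1" for v
      using linear_scale[OF has_derivative_linear[OF D], of v 1] by simp
    then have "?D = (\<lambda>v. v *\<^sub>R ?D 1)" by (rule ext)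
    then have "(F has_vector_derivative ?D 1) (at \<tau> within {s..t})"
      using D unfolding has_vector_derivative_def by metis
    then have "vector_derivative F (at \<tau> within cbox s t) = ?D 1"
      using vector_derivative_within_cbox[of s t \<tau> F "?D 1"] assms that by auto
    moreover have "vector_derivative F (at \<tau> within cbox s t) = F' \<tau>"
      using vector_derivative_within_cbox[of s t \<tau> F "F' \<tau>"] F'[OF that] assms that by auto
    ultimately show ?thesis using lin by metis
  qed
  then have "continuous_on {s..t} (\<lambda>\<tau>. frechet_derivative F (at \<tau> within {s..t}) v)" for v
    using cont by (subst continuous_on_cong[OF refl, of _ _ "\<lambda>\<tau>. v *\<^sub>R F' \<tau>"])
      (auto intro!: continuous_intros)
  then show "Ck_on 1 {s..t} F"
    using diff by (auto simp: One_nat_def differentiable_on_def)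
qed

lemma C1_affine_reparametrization:
  fixes G :: "real \<Rightarrow> 'b::real_normed_vector"
  assumes G: "Ck_on 1 {s'..t'} G" and "m \<noteq> 0" "s < t"
    and sub: "\<And>\<tau>. \<tau> \<in> {s..t} \<Longrightarrow> m * \<tau> + c \<in> {s'..t'}"
    and F: "\<And>\<tau>. \<tau> \<in> {s..t} \<Longrightarrow> F \<tau> = G (m * \<tau> + c)"
  shows "Ck_on 1 {s..t} F"
proof -
  have "s' < t'"
  proof -
    have "m * s + c \<noteq> m * t + c" using assms by auto
    moreover have "m * s + c \<in> {s'..t'}" "m * t + c \<in> {s'..t'}"
      using sub[of s] sub[of t] \<open>s < t\<close> by auto
    ultimately show ?thesis unfolding atLeastAtMost_iff by linarith
  qed
  then obtain G' where G': "continuous_on {s'..t'} G'"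
    "\<And>\<tau>. \<tau> \<in> {s'..t'} \<Longrightarrow> (G has_vector_derivative G' \<tau>) (at \<tau> within {s'..t'})"
    using G C1_interval_iff by blast
  have "continuous_on {s..t} (\<lambda>\<tau>. m *\<^sub>R G' (m * \<tau> + c))"
    using sub by (intro continuous_intros continuous_on_compose2[OF G'(1)]) auto
  moreover have "(F has_vector_derivative m *\<^sub>R G' (m * \<tau> + c)) (at \<tau> within {s..t})"
    if \<tau>: "\<tau> \<in> {s..t}" for \<tau>
  proof -
    have "((\<lambda>\<tau>. m * \<tau> + c) has_vector_derivative m) (at \<tau> within {s..t})"
      by (auto intro!: derivative_eq_intros)
    moreover have "(G has_vector_derivative G' (m * \<tau> + c))
        (at (m * \<tau> + c) within (\<lambda>\<tau>. m * \<tau> + c) ` {s..t})"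
      using G'(2)[OF sub[OF \<tau>]] sub by (rule_tac has_vector_derivative_within_subset) auto
    ultimately have "((G \<circ> (\<lambda>\<tau>. m * \<tau> + c)) has_vector_derivative m *\<^sub>R G' (m * \<tau> + c))
        (at \<tau> within {s..t})"
      using vector_diff_chain_within[of "\<lambda>\<tau>. m * \<tau> + c" m \<tau> "{s..t}" G] by auto
    then show ?thesis
      by (rule has_vector_derivative_transform[rotated 2]) (use \<tau> F in auto)
  qed
  ultimately show ?thesis
    using \<open>s < t\<close> C1_interval_iff by blast
qed

section \<open>Charts\<close>

context
  fixes S :: "('i, 'a::{t2_space, second_countable_topology}, 'e::euclidean_space) rmfd"
  assumes S: "smooth_manifold S"
begin

lemma openin_chart_dom: "openin (top_of_set (carrier S)) (chart_dom S i)"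
  using S by (simp add: smooth_manifold_def)

lemma open_chart_img: "open (chart_img S i)"
  using S by (simp add: smooth_manifold_def)

lemma chart_homeomorphism:
  "homeomorphism (chart_dom S i) (chart_img S i) (chart_map S i) (chart_inv S i)"
  using S by (simp add: smooth_manifold_def)

lemma chart_inv_map: "p \<in> chart_dom S i \<Longrightarrow> chart_inv S i (chart_map S i p) = p"
  using chart_homeomorphism[of i] by (auto simp: homeomorphism_def)

lemma chart_map_inv: "u \<in> chart_img S i \<Longrightarrow> chart_map S i (chart_inv S i u) = u"
  using chart_homeomorphism[of i] by (auto simp: homeomorphism_def)

lemma chart_inv_in_dom: "u \<in> chart_img S i \<Longrightarrow> chart_inv S i u \<in> chart_dom S i"
  using chart_homeomorphism[of i] by (auto simp: homeomorphism_def)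

lemma chart_map_in_img: "p \<in> chart_dom S i \<Longrightarrow> chart_map S i p \<in> chart_img S i"
  by (auto simp: chart_img_def)

lemma continuous_on_chart_map: "continuous_on (chart_dom S i) (chart_map S i)"
  using chart_homeomorphism[of i] by (auto simp: homeomorphism_def)

lemma continuous_on_chart_inv: "continuous_on (chart_img S i) (chart_inv S i)"
  using chart_homeomorphism[of i] by (auto simp: homeomorphism_def)

lemma chart_dom_subset: "chart_dom S i \<subseteq> carrier S"
  by (auto simp: carrier_def)

lemma open_chart_map_image:
  assumes "openin (top_of_set (carrier S)) U" "U \<subseteq> chart_dom S i"
  shows "open (chart_map S i ` U)"
proof -
  have "openin (top_of_set (chart_dom S i)) U"
    using assms chart_dom_subset by (metis openin_subset_trans)
  then have "openin (top_of_set (chart_img S i)) (chart_map S i ` U)"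
    by (rule homeomorphism_imp_open_map[OF chart_homeomorphism])
  then show ?thesis
    using open_chart_img openin_open_trans by blast
qed

lemma openin_chart_inv_image:
  assumes "open V" "V \<subseteq> chart_img S i"
  shows "openin (top_of_set (carrier S)) (chart_inv S i ` V)"
proof -
  have "openin (top_of_set (chart_img S i)) V"
    using assms by (auto intro: open_subset)
  then have "openin (top_of_set (chart_dom S i)) (chart_inv S i ` V)"
    using homeomorphism_imp_open_map[OF homeomorphism_symD[OF chart_homeomorphism]] by blast
  then show ?thesis
    using openin_chart_dom openin_trans by blast
qed

lemma compact_chart_inv_image:
  assumes "compact K" "K \<subseteq> chart_img S i"
  shows "compact (chart_inv S i ` K)"
  using assms continuous_on_chart_inv compact_continuous_image continuous_on_subset by blast

lemma chart_ball_exists: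
  assumes "p \<in> chart_dom S i"
  obtains r where "r > 0" "cball (chart_map S i p) r \<subseteq> chart_img S i"
  using open_chart_img chart_map_in_img[OF assms] open_contains_cball by metis

lemma open_overlap: "open (chart_map S i ` (chart_dom S i \<inter> chart_dom S j))"
  by (intro open_chart_map_image openin_Int openin_chart_dom) auto

lemma transition_has_derivative:
  assumes "p \<in> chart_dom S i \<inter> chart_dom S j"
  shows "((chart_map S j \<circ> chart_inv S i) has_derivative transition_deriv S i j p)
    (at (chart_map S i p))"
proof -
  let ?O = "chart_map S i ` (chart_dom S i \<inter> chart_dom S j)"
  have "Ck_on (Suc 0) ?O (chart_map S j \<circ> chart_inv S i)"
    using S by (auto simp: smooth_manifold_def smooth_on_def)
  then have "(chart_map S j \<circ> chart_inv S i) differentiable (at (chart_map S i p) within ?O)"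
    using assms by (auto simp: differentiable_on_def)
  then show ?thesis
    using assms open_overlap[of i j] at_within_open[of "chart_map S i p" ?O]
    unfolding transition_deriv_def frechet_derivative_works by auto
qed

lemma continuous_on_transition_derivative:
  "continuous_on (chart_map S i ` (chart_dom S i \<inter> chart_dom S j))
     (\<lambda>u. transition_deriv S i j (chart_inv S i u) v)"
proof -
  let ?O = "chart_map S i ` (chart_dom S i \<inter> chart_dom S j)"
  have "Ck_on (Suc 0) ?O (chart_map S j \<circ> chart_inv S i)"
    using S by (auto simp: smooth_manifold_def smooth_on_def)
  then have "continuous_on ?O
      (\<lambda>u. frechet_derivative (chart_map S j \<circ> chart_inv S i) (at u within ?O) v)"
    by auto
  then show ?thesis
    by (rule continuous_on_eq) (auto simp: transition_deriv_def chart_inv_map)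
qed

end

section \<open>Length of tangent vectors\<close>

definition tangent_norm ::
  "('i, 'a, 'e) rmfd \<Rightarrow> 'i \<Rightarrow> 'a \<Rightarrow> 'e \<Rightarrow> real" where
  "tangent_norm S i p v = sqrt (chart_metric S i p v v)"

context
  fixes S :: "('i, 'a::{t2_space, second_countable_topology}, 'e::euclidean_space) rmfd"
  assumes R: "riemannian_manifold S"
begin

lemma riemannian_smooth_manifold: "smooth_manifold S"
  using R by (simp add: riemannian_manifold_def)

lemma chart_metric_bilinear: "p \<in> chart_dom S i \<Longrightarrow> bilinear (chart_metric S i p)"
  using R by (simp add: riemannian_manifold_def)

lemma chart_metric_pos: "p \<in> chart_dom S i \<Longrightarrow> v \<noteq> 0 \<Longrightarrow> chart_metric S i p v v > 0"
  using R by (simp add: riemannian_manifold_def)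

lemma chart_metric_nonneg: "p \<in> chart_dom S i \<Longrightarrow> chart_metric S i p v v \<ge> 0"
  using chart_metric_pos[of p i v] bilinear_lzero[OF chart_metric_bilinear, of p i v]
  by (cases "v = 0") auto

lemma tangent_norm_nonneg: "p \<in> chart_dom S i \<Longrightarrow> tangent_norm S i p v \<ge> 0"
  by (simp add: tangent_norm_def chart_metric_nonneg)

lemma tangent_norm_scale:
  "p \<in> chart_dom S i \<Longrightarrow> tangent_norm S i p (c *\<^sub>R v) = \<bar>c\<bar> * tangent_norm S i p v"
  using bilinear_lmul[OF chart_metric_bilinear, of p i c v "c *\<^sub>R v"]
    bilinear_rmul[OF chart_metric_bilinear, of p i v c v]
    real_sqrt_mult[of "c\<^sup>2" "chart_metric S i p v v"]
  by (simp add: tangent_norm_def power2_eq_square mult.assoc)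

lemma tangent_norm_transition:
  "p \<in> chart_dom S i \<inter> chart_dom S j \<Longrightarrow>
   tangent_norm S j p (transition_deriv S i j p v) = tangent_norm S i p v"
  using R by (simp add: riemannian_manifold_def tangent_norm_def)

text \<open>
  Smoothness is only given for each metric coefficient separately; expanding both arguments in
  the basis makes the metric jointly continuous in the point and the vector.
\<close>

lemma continuous_on_tangent_norm:
  "continuous_on (chart_img S i \<times> UNIV) (\<lambda>(u, v). tangent_norm S i (chart_inv S i u) v)"
proof -
  let ?g = "\<lambda>u. chart_metric S i (chart_inv S i u)"
  have expand: "?g u v v = (\<Sum>(b, b')\<in>Basis \<times> Basis. (v \<bullet> b) * (v \<bullet> b') * ?g u b b')"
    if "u \<in> chart_img S i" for u v
  proof -
    have b: "bilinear (?g u)"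
      using that by (intro chart_metric_bilinear chart_inv_in_dom riemannian_smooth_manifold)
    have "?g u v v = ?g u (\<Sum>b\<in>Basis. (v \<bullet> b) *\<^sub>R b) (\<Sum>b\<in>Basis. (v \<bullet> b) *\<^sub>R b)"
      by (simp add: euclidean_representation)
    also have "\<dots> = (\<Sum>(b, b')\<in>Basis \<times> Basis. (v \<bullet> b) * (v \<bullet> b') * ?g u b b')"
      unfolding bilinear_sum[OF b]
      by (intro sum.cong refl) (simp add: split_beta bilinear_lmul[OF b] bilinear_rmul[OF b])
    finally show ?thesis .
  qed
  have "Ck_on 0 (chart_img S i) (\<lambda>u. ?g u v w)" for v w
    using R by (auto simp: riemannian_manifold_def smooth_on_def)
  then have cont: "continuous_on (chart_img S i) (\<lambda>u. ?g u v w)" for v w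
    by simp
  have "continuous_on (chart_img S i \<times> UNIV)
      (\<lambda>z. \<Sum>b\<in>Basis \<times> Basis. (snd z \<bullet> fst b) * (snd z \<bullet> snd b) * ?g (fst z) (fst b) (snd b))"
    by (intro continuous_intros continuous_on_compose2[OF cont]) auto
  then have "continuous_on (chart_img S i \<times> UNIV)
      (\<lambda>z. sqrt (\<Sum>b\<in>Basis \<times> Basis. (snd z \<bullet> fst b) * (snd z \<bullet> snd b) * ?g (fst z) (fst b) (snd b)))"
    by (rule continuous_on_real_sqrt)
  then show ?thesis
    by (rule continuous_on_eq) (auto simp: tangent_norm_def expand split_beta)
qed

text \<open>
  By homogeneity it suffices to bound the norm on unit vectors, and these form together with
  \<open>K\<close> a compact set.
\<close>

lemma tangent_norm_bounds:
  assumes "compact K" "K \<subseteq> chart_img S i"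
  obtains c C where "0 < c" "0 < C"
    "\<And>u v. u \<in> K \<Longrightarrow> c * norm v \<le> tangent_norm S i (chart_inv S i u) v"
    "\<And>u v. u \<in> K \<Longrightarrow> tangent_norm S i (chart_inv S i u) v \<le> C * norm v"
proof (cases "K = {}")
  case True
  show thesis using that[of 1 1] True by auto
next
  case False
  let ?\<phi> = "\<lambda>(u, v). tangent_norm S i (chart_inv S i u) v"
  let ?B = "K \<times> sphere (0::'e) 1"
  obtain e :: 'e where e: "norm e = 1" using vector_choose_size[of 1] by auto
  have "compact ?B" "?B \<noteq> {}"
    using False assms(1) e by (auto intro!: compact_Times)
  moreover have "continuous_on ?B ?\<phi>"
    using continuous_on_tangent_norm assms by (auto intro: continuous_on_subset)
  ultimately obtain m M where m: "m \<in> ?B" "\<And>z. z \<in> ?B \<Longrightarrow> ?\<phi> m \<le> ?\<phi> z"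
    and M: "\<And>z. z \<in> ?B \<Longrightarrow> ?\<phi> z \<le> ?\<phi> M"
    using continuous_attains_inf[of ?B ?\<phi>] continuous_attains_sup[of ?B ?\<phi>] by metis
  have pos: "0 < ?\<phi> m"
  proof -
    have "chart_inv S i (fst m) \<in> chart_dom S i" "snd m \<noteq> 0"
      using m(1) assms chart_inv_in_dom[OF riemannian_smooth_manifold] by auto
    then show ?thesis by (auto simp: tangent_norm_def chart_metric_pos split_beta)
  qed
  then have posM: "0 < ?\<phi> M" using m M by fastforce
  have scaled: "tangent_norm S i (chart_inv S i u) v = norm v * ?\<phi> (u, v /\<^sub>R norm v)"
    if "u \<in> K" "v \<noteq> 0" for u v
  proof -
    have "chart_inv S i u \<in> chart_dom S i"
      using that assms chart_inv_in_dom[OF riemannian_smooth_manifold] by auto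
    from tangent_norm_scale[OF this, of "norm v" "v /\<^sub>R norm v"] that show ?thesis by simp
  qed
  have zero: "tangent_norm S i (chart_inv S i u) 0 = 0" if "u \<in> K" for u
  proof -
    have "chart_inv S i u \<in> chart_dom S i"
      using that assms chart_inv_in_dom[OF riemannian_smooth_manifold] by auto
    from tangent_norm_scale[OF this, of 0 0] show ?thesis by simp
  qed
  have in_B: "(u, v /\<^sub>R norm v) \<in> ?B" if "u \<in> K" "v \<noteq> 0" for u v
    using that by simp
  show thesis
  proof (rule that[OF pos posM])
    fix u and v :: 'e assume u: "u \<in> K"
    show "?\<phi> m * norm v \<le> tangent_norm S i (chart_inv S i u) v"
      using u m(2)[OF in_B, of u v] scaled[of u v] zero[of u]
      by (cases "v = 0") (auto simp: mult.commute)
    show "tangent_norm S i (chart_inv S i u) v \<le> ?\<phi> M * norm v"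
      using u M[OF in_B, of u v] scaled[of u v] zero[of u]
      by (cases "v = 0") (auto simp: mult.commute)
  qed
qed

end

section \<open>Speed and length of curves\<close>

text \<open>The differentiability condition in \<open>piecewise_C1_curve\<close>, with the set of break points exposed.\<close>

definition C1_off ::
  "('i, 'a::topological_space, 'e::euclidean_space) rmfd \<Rightarrow> (real \<Rightarrow> 'a) \<Rightarrow> real set \<Rightarrow> bool" where
  "C1_off S \<gamma> T \<longleftrightarrow>
     (\<forall>i s t. 0 \<le> s \<and> s < t \<and> t \<le> 1 \<and> {s<..<t} \<inter> T = {} \<and> \<gamma> ` {s..t} \<subseteq> chart_dom S i
        \<longrightarrow> Ck_on 1 {s..t} (chart_map S i \<circ> \<gamma>))"

lemma piecewise_C1_curve_iff:
  "piecewise_C1_curve S \<gamma> \<longleftrightarrow> continuous_on {0..1} \<gamma> \<and> \<gamma> ` {0..1} \<subseteq> carrier S \<and>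
     (\<exists>T. finite T \<and> C1_off S \<gamma> T)"
  by (simp add: piecewise_C1_curve_def C1_off_def)

lemma C1_offD:
  "C1_off S \<gamma> T \<Longrightarrow> 0 \<le> s \<Longrightarrow> s < t \<Longrightarrow> t \<le> 1 \<Longrightarrow> {s<..<t} \<inter> T = {} \<Longrightarrow>
   \<gamma> ` {s..t} \<subseteq> chart_dom S i \<Longrightarrow> Ck_on 1 {s..t} (chart_map S i \<circ> \<gamma>)"
  unfolding C1_off_def by blast

lemma chart_at_dom: "p \<in> carrier S \<Longrightarrow> p \<in> chart_dom S (chart_at S p)"
  unfolding chart_at_def carrier_def by (rule someI_ex) auto

context
  fixes S :: "('i, 'a::{t2_space, second_countable_topology}, 'e::euclidean_space) rmfd"
  assumes R: "riemannian_manifold S"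
begin

text \<open>
  The speed is defined through the chart that \<open>chart_at\<close> picks at each point separately, so it
  can only be treated as a function of time after it is expressed in one fixed chart.
\<close>

lemma speed_in_chart:
  assumes "a < t" "t < b" and dom: "\<gamma> ` {a<..<b} \<subseteq> chart_dom S i"
    and w: "((chart_map S i \<circ> \<gamma>) has_vector_derivative w) (at t)"
  shows "speed S \<gamma> t = tangent_norm S i (\<gamma> t) w"
proof -
  note S = riemannian_smooth_manifold[OF R]
  define j where "j = chart_at S (\<gamma> t)"
  have i: "\<gamma> t \<in> chart_dom S i" using assms by auto
  then have "\<gamma> t \<in> carrier S" by (auto simp: carrier_def)
  then have j: "\<gamma> t \<in> chart_dom S j"
    by (simp add: j_def chart_at_dom)
  have "((chart_map S j \<circ> chart_inv S i) has_derivative transition_deriv S i j (\<gamma> t))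
      (at ((chart_map S i \<circ> \<gamma>) t))"
    using transition_has_derivative[OF S, of "\<gamma> t" i j] i j by simp
  then have "((\<lambda>\<tau>. (chart_map S j \<circ> chart_inv S i) ((chart_map S i \<circ> \<gamma>) \<tau>)) has_derivative
      (\<lambda>h. transition_deriv S i j (\<gamma> t) (h *\<^sub>R w))) (at t)"
    using has_derivative_compose[OF w[unfolded has_vector_derivative_def]] by blast
  then have "((\<lambda>\<tau>. (chart_map S j \<circ> chart_inv S i) ((chart_map S i \<circ> \<gamma>) \<tau>)) has_vector_derivative
      transition_deriv S i j (\<gamma> t) w) (at t)"
    using linear_scale[OF has_derivative_linear[OF transition_has_derivative[OF S]], of "\<gamma> t" i j _ w] i j
    by (simp add: has_vector_derivative_def)
  then have "((chart_map S j \<circ> \<gamma>) has_vector_derivative transition_deriv S i j (\<gamma> t) w) (at t)"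
  proof (rule has_vector_derivative_transform_within_open[of _ _ _ "{a<..<b}"])
    fix \<tau> assume "\<tau> \<in> {a<..<b}"
    then have "\<gamma> \<tau> \<in> chart_dom S i" using dom by auto
    then show "(chart_map S j \<circ> chart_inv S i) ((chart_map S i \<circ> \<gamma>) \<tau>) = (chart_map S j \<circ> \<gamma>) \<tau>"
      using chart_inv_map[OF S] by simp
  qed (use assms in auto)
  then have "vector_derivative (chart_map S j \<circ> \<gamma>) (at t) = transition_deriv S i j (\<gamma> t) w"
    by (rule vector_derivative_at)
  then have "speed S \<gamma> t = tangent_norm S j (\<gamma> t) (transition_deriv S i j (\<gamma> t) w)"
    by (simp add: speed_def j_def Let_def tangent_norm_def)
  then show ?thesis
    using tangent_norm_transition[OF R] i j by simp
qed

lemma continuous_chart_nhd: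
  fixes \<gamma> :: "real \<Rightarrow> 'a"
  assumes cont: "continuous_on {0..1} \<gamma>" and sub: "\<gamma> ` {0..1} \<subseteq> carrier S"
    and t: "t \<in> {0..1}" and i: "\<gamma> t \<in> chart_dom S i"
  obtains d where "d > 0" "\<And>s. s \<in> {0..1} \<Longrightarrow> \<bar>s - t\<bar> < d \<Longrightarrow> \<gamma> s \<in> chart_dom S i"
proof -
  obtain U where U: "open U" "chart_dom S i = carrier S \<inter> U"
    using openin_chart_dom[OF riemannian_smooth_manifold[OF R], of i] by (auto simp: openin_open)
  obtain A where A: "open A" "A \<inter> {0..1} = \<gamma> -` U \<inter> {0..1}"
    using cont U(1) unfolding continuous_on_open_invariant by blast
  then have "t \<in> A" using U i t by blast
  then obtain d where d: "d > 0" "ball t d \<subseteq> A"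
    using A(1) open_contains_ball by blast
  show thesis
  proof (rule that[OF d(1)])
    fix s assume s: "s \<in> {0..1::real}" "\<bar>s - t\<bar> < d"
    then have "s \<in> A" using d(2) by (auto simp: dist_real_def abs_minus_commute subset_iff)
    then show "\<gamma> s \<in> chart_dom S i" using A(2) U(2) s(1) sub by blast
  qed
qed

text \<open>
  As the break points are finitely many, near the time \<open>t\<close> the curve can be irregular at \<open>t\<close>
  itself only: it is C1 on both sides of \<open>t\<close>, and across \<open>t\<close> unless \<open>t\<close> is a break point.
\<close>

lemma C1_chart_nhd:
  assumes cont: "continuous_on {0..1} \<gamma>" and sub: "\<gamma> ` {0..1} \<subseteq> carrier S"
    and T: "finite T" "C1_off S \<gamma> T"
    and t: "t \<in> {0..1}" and i: "\<gamma> t \<in> chart_dom S i"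
  obtains d where "d > 0" "\<And>s. s \<in> {0..1} \<Longrightarrow> \<bar>s - t\<bar> < d \<Longrightarrow> \<gamma> s \<in> chart_dom S i"
    "\<And>a b. 0 \<le> a \<Longrightarrow> a < b \<Longrightarrow> b \<le> 1 \<Longrightarrow> t - d < a \<Longrightarrow> b < t + d \<Longrightarrow> t \<notin> {a<..<b} \<inter> T \<Longrightarrow>
       Ck_on 1 {a..b} (chart_map S i \<circ> \<gamma>)"
proof -
  obtain d where d: "d > 0" "\<And>s. s \<in> {0..1} \<Longrightarrow> \<bar>s - t\<bar> < d \<Longrightarrow> \<gamma> s \<in> chart_dom S i"
    using continuous_chart_nhd[OF cont sub t i] by blast
  obtain e where e: "e > 0" "\<And>s. s \<in> T \<Longrightarrow> s \<noteq> t \<Longrightarrow> e \<le> dist t s"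
    using finite_set_avoid[OF T(1)] by blast
  show thesis
  proof (rule that[of "min d e"])
    fix a b :: real
    assume ab: "0 \<le> a" "a < b" "b \<le> 1" "t - min d e < a" "b < t + min d e" "t \<notin> {a<..<b} \<inter> T"
    have near: "\<bar>s - t\<bar> < min d e" if "s \<in> {a..b}" for s
      using ab(4,5) that unfolding atLeastAtMost_iff by linarith
    have "s \<notin> T" if "s \<in> {a<..<b}" for s
      using near[of s] e(2)[of s] ab(6) that by (auto simp: dist_real_def abs_minus_commute)
    moreover have "\<gamma> ` {a..b} \<subseteq> chart_dom S i"
      using near d(2) ab by fastforce
    ultimately show "Ck_on 1 {a..b} (chart_map S i \<circ> \<gamma>)"
      using ab by (intro C1_offD[OF T(2)]) auto
  qed (use d e in auto)
qed

lemma curve_has_velocity: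
  assumes cont: "continuous_on {0..1} \<gamma>" and sub: "\<gamma> ` {0..1} \<subseteq> carrier S"
    and T: "finite T" "C1_off S \<gamma> T"
    and t: "t \<in> {0<..<1} - T" and i: "\<gamma> t \<in> chart_dom S i"
  obtains w where "((chart_map S i \<circ> \<gamma>) has_vector_derivative w) (at t)"
    "speed S \<gamma> t = tangent_norm S i (\<gamma> t) w"
proof -
  have t01: "t \<in> {0..1}" using t by auto
  obtain d where d: "d > 0" "\<And>s. s \<in> {0..1} \<Longrightarrow> \<bar>s - t\<bar> < d \<Longrightarrow> \<gamma> s \<in> chart_dom S i"
    and C1: "\<And>a b. 0 \<le> a \<Longrightarrow> a < b \<Longrightarrow> b \<le> 1 \<Longrightarrow> t - d < a \<Longrightarrow> b < t + d \<Longrightarrow> t \<notin> {a<..<b} \<inter> T \<Longrightarrow>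
       Ck_on 1 {a..b} (chart_map S i \<circ> \<gamma>)"
    using C1_chart_nhd[OF cont sub T t01 i] by blast
  define \<epsilon> where "\<epsilon> = min (d / 2) (min t (1 - t))"
  have \<epsilon>: "0 < \<epsilon>" "\<epsilon> < d" "\<epsilon> \<le> t" "\<epsilon> \<le> 1 - t" using d(1) t by (auto simp: \<epsilon>_def)
  have "Ck_on 1 {t - \<epsilon>..t + \<epsilon>} (chart_map S i \<circ> \<gamma>)"
    using \<epsilon> t by (intro C1) auto
  then obtain F' where F': "\<forall>\<tau>\<in>{t - \<epsilon>..t + \<epsilon>}.
      ((chart_map S i \<circ> \<gamma>) has_vector_derivative F' \<tau>) (at \<tau> within {t - \<epsilon>..t + \<epsilon>})"
    using C1_interval_iff[of "t - \<epsilon>" "t + \<epsilon>" "chart_map S i \<circ> \<gamma>"] \<epsilon>(1) by auto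
  define w where "w = F' t"
  have "((chart_map S i \<circ> \<gamma>) has_vector_derivative w) (at t within {t - \<epsilon>..t + \<epsilon>})"
    using F' \<epsilon>(1) by (simp add: w_def)
  then have w: "((chart_map S i \<circ> \<gamma>) has_vector_derivative w) (at t)"
    using \<epsilon>(1) at_within_Icc_at[of "t - \<epsilon>" t "t + \<epsilon>"] by simp
  have "speed S \<gamma> t = tangent_norm S i (\<gamma> t) w"
    using \<epsilon> t by (intro speed_in_chart[OF _ _ _ w, of "t - \<epsilon>" "t + \<epsilon>"]) (auto intro!: d(2))
  with w that show thesis by blast
qed

lemma speed_nonneg: "\<gamma> t \<in> carrier S \<Longrightarrow> speed S \<gamma> t \<ge> 0"
  using chart_metric_nonneg[OF R chart_at_dom] by (simp add: speed_def Let_def)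

lemma speed_integrable_in_chart:
  assumes "a < b" and dom: "\<gamma> ` {a..b} \<subseteq> chart_dom S i"
    and C1: "Ck_on 1 {a..b} (chart_map S i \<circ> \<gamma>)"
  shows "speed S \<gamma> integrable_on {a..b}"
proof -
  note S = riemannian_smooth_manifold[OF R]
  obtain F' where F': "continuous_on {a..b} F'"
    "\<And>\<tau>. \<tau> \<in> {a..b} \<Longrightarrow> ((chart_map S i \<circ> \<gamma>) has_vector_derivative F' \<tau>) (at \<tau> within {a..b})"
    using C1 C1_interval_iff[OF \<open>a < b\<close>] by blast
  have contF: "continuous_on {a..b} (chart_map S i \<circ> \<gamma>)"
    using F'(2) has_vector_derivative_continuous continuous_on_eq_continuous_within by blast
  let ?g = "\<lambda>\<tau>. tangent_norm S i (chart_inv S i ((chart_map S i \<circ> \<gamma>) \<tau>)) (F' \<tau>)"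
  have "continuous_on {a..b} (\<lambda>\<tau>. ((chart_map S i \<circ> \<gamma>) \<tau>, F' \<tau>))"
    using contF F'(1) by (intro continuous_on_Pair)
  moreover have "(\<lambda>\<tau>. ((chart_map S i \<circ> \<gamma>) \<tau>, F' \<tau>)) ` {a..b} \<subseteq> chart_img S i \<times> UNIV"
    using dom by (auto simp: chart_img_def)
  ultimately have "continuous_on {a..b} ?g"
    using continuous_on_compose2[OF continuous_on_tangent_norm[OF R, of i], of "{a..b}"
        "\<lambda>\<tau>. ((chart_map S i \<circ> \<gamma>) \<tau>, F' \<tau>)"] by simp
  then have "?g integrable_on {a..b}"
    by (rule integrable_continuous_interval)
  moreover have "speed S \<gamma> \<tau> = ?g \<tau>" if "\<tau> \<in> {a..b} - {a, b}" for \<tau>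
  proof -
    have "((chart_map S i \<circ> \<gamma>) has_vector_derivative F' \<tau>) (at \<tau>)"
      using F'(2)[of \<tau>] that at_within_Icc_at[of a \<tau> b] by auto
    then have "speed S \<gamma> \<tau> = tangent_norm S i (\<gamma> \<tau>) (F' \<tau>)"
      using that dom by (intro speed_in_chart[of a \<tau> b]) auto
    moreover have "\<gamma> \<tau> \<in> chart_dom S i" using that dom by auto
    ultimately show ?thesis using chart_inv_map[OF S] by simp
  qed
  ultimately show ?thesis
    using integrable_spike_finite[of "{a, b}" "{a..b}" "speed S \<gamma>" ?g] by auto
qed

text \<open>
  \<open>integral\<close> is 0 for functions that are not integrable, so lengths of curves mean nothing without
  this lemma. Integrability is local in time and passes to adjacent intervals, hence it holds
  on the whole interval by bisection.
\<close>

lemma speed_integrable: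
  assumes "piecewise_C1_curve S \<gamma>"
  shows "speed S \<gamma> integrable_on {0..1}"
proof -
  obtain T where cont: "continuous_on {0..1} \<gamma>" and sub: "\<gamma> ` {0..1} \<subseteq> carrier S"
    and T: "finite T" "C1_off S \<gamma> T"
    using assms by (auto simp: piecewise_C1_curve_iff)
  have "0 \<le> (0::real) \<and> (1::real) \<le> 1 \<longrightarrow> speed S \<gamma> integrable_on {0..1}"
  proof (rule Bolzano[where P = "\<lambda>a b. 0 \<le> a \<and> b \<le> 1 \<longrightarrow> speed S \<gamma> integrable_on {a..b}"])
    fix a b c :: real
    assume "0 \<le> a \<and> b \<le> 1 \<longrightarrow> speed S \<gamma> integrable_on {a..b}"
      "0 \<le> b \<and> c \<le> 1 \<longrightarrow> speed S \<gamma> integrable_on {b..c}" "a \<le> b" "b \<le> c"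
    then show "0 \<le> a \<and> c \<le> 1 \<longrightarrow> speed S \<gamma> integrable_on {a..c}"
      using Henstock_Kurzweil_Integration.integrable_combine[of a b c "speed S \<gamma>"] by auto
  next
    fix t :: real assume t: "0 \<le> t" "t \<le> 1"
    define i where "i = chart_at S (\<gamma> t)"
    have t01: "t \<in> {0..1}" using t by auto
    have "\<gamma> t \<in> carrier S" using sub t01 by blast
    then have i: "\<gamma> t \<in> chart_dom S i"
      unfolding i_def by (rule chart_at_dom)
    obtain d where d: "d > 0" "\<And>s. s \<in> {0..1} \<Longrightarrow> \<bar>s - t\<bar> < d \<Longrightarrow> \<gamma> s \<in> chart_dom S i"
      and C1: "\<And>a b. 0 \<le> a \<Longrightarrow> a < b \<Longrightarrow> b \<le> 1 \<Longrightarrow> t - d < a \<Longrightarrow> b < t + d \<Longrightarrow> t \<notin> {a<..<b} \<inter> T \<Longrightarrow>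
         Ck_on 1 {a..b} (chart_map S i \<circ> \<gamma>)"
      using C1_chart_nhd[OF cont sub T t01 i] by blast
    have piece: "speed S \<gamma> integrable_on {a..b}"
      if "0 \<le> a" "b \<le> 1" "a \<le> b" "t - d < a" "b < t + d" "t \<notin> {a<..<b}" for a b
    proof (cases "a = b")
      case False
      with that show ?thesis
        by (intro speed_integrable_in_chart[of _ _ _ i] C1) (auto intro!: d(2))
    qed (use integrable_on_refl[of "speed S \<gamma>" a] in auto)
    show "\<exists>d>0. \<forall>a b. a \<le> t \<and> t \<le> b \<and> b - a < d \<longrightarrow>
        0 \<le> a \<and> b \<le> 1 \<longrightarrow> speed S \<gamma> integrable_on {a..b}"
    proof (intro exI[of _ d] conjI allI impI, use d in simp)
      fix a b assume ab: "a \<le> t \<and> t \<le> b \<and> b - a < d" "0 \<le> a \<and> b \<le> 1"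
      then have "speed S \<gamma> integrable_on {a..t}" "speed S \<gamma> integrable_on {t..b}"
        using d(1) t by (auto intro!: piece)
      then show "speed S \<gamma> integrable_on {a..b}"
        using Henstock_Kurzweil_Integration.integrable_combine[of a t b "speed S \<gamma>"] ab by auto
    qed
  qed simp
  then show ?thesis by simp
qed

lemma curve_length_nonneg:
  assumes "piecewise_C1_curve S \<gamma>"
  shows "curve_length S \<gamma> \<ge> 0"
  unfolding curve_length_def
proof (rule integral_nonneg[OF speed_integrable[OF assms]])
  fix t :: real assume "t \<in> {0..1}"
  then show "0 \<le> speed S \<gamma> t"
    using assms by (intro speed_nonneg) (auto simp: piecewise_C1_curve_def)
qed

end

section \<open>Length estimates in a chart\<close>

context
  fixes S :: "('i, 'a::{t2_space, second_countable_topology}, 'e::euclidean_space) rmfd"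
  assumes R: "riemannian_manifold S"
begin

text \<open>
  Until it first leaves the ball, the curve moves in the chart with a Euclidean speed of at most
  its Riemannian speed divided by \<open>c\<close>, and it has to cover the Euclidean distance \<open>\<rho>\<close>.
\<close>

lemma curve_length_escape:
  assumes \<gamma>: "piecewise_C1_curve S \<gamma>" and "\<rho> > 0" "c > 0"
    and img: "cball u \<rho> \<subseteq> chart_img S i"
    and bound: "\<And>y v. y \<in> cball u \<rho> \<Longrightarrow> c * norm v \<le> tangent_norm S i (chart_inv S i y) v"
    and start: "\<gamma> 0 = chart_inv S i u" and finish: "\<gamma> 1 \<notin> chart_inv S i ` ball u \<rho>"
  shows "c * \<rho> \<le> curve_length S \<gamma>"
proof -
  note S = riemannian_smooth_manifold[OF R]
  obtain T where cont: "continuous_on {0..1} \<gamma>" and sub: "\<gamma> ` {0..1} \<subseteq> carrier S"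
    and T: "finite T" "C1_off S \<gamma> T"
    using \<gamma> by (auto simp: piecewise_C1_curve_iff)
  let ?V = "chart_inv S i ` ball u \<rho>" and ?W = "chart_inv S i ` cball u \<rho>"
  have "openin (top_of_set (carrier S)) ?V"
    using img ball_subset_cball by (intro openin_chart_inv_image[OF S]) blast+
  then obtain U where U: "open U" "?V = carrier S \<inter> U"
    unfolding openin_open by blast
  \<comment> \<open>The times outside the ball; the least of them is the exit time.\<close>
  define K where "K = {0..1} \<inter> \<gamma> -` (- U)"
  have K_iff: "t \<in> K \<longleftrightarrow> t \<in> {0..1} \<and> \<gamma> t \<notin> ?V" for t
    unfolding K_def U(2) using sub by blast
  have "closed K"
    unfolding K_def using U(1) by (intro continuous_closed_preimage[OF cont]) auto
  then have "compact K"
    using compact_Int_closed[of "{0..1}" K] by (simp add: K_def Int_absorb1 flip: Int_assoc)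
  moreover have "1 \<in> K" using finish by (simp add: K_iff)
  ultimately obtain e where e: "e \<in> K" "\<And>t. t \<in> K \<Longrightarrow> e \<le> t"
    using compact_attains_inf[of K] by blast
  have e01: "e \<in> {0..1}" and "e \<noteq> 0"
    using e(1) start \<open>\<rho> > 0\<close> by (auto simp: K_iff)
  then have "e > 0" by auto
  have before: "\<gamma> t \<in> ?V" if "t \<in> {0..<e}" for t
    using e(2)[of t] that e01 K_iff[of t] by fastforce
  have inW: "\<gamma> t \<in> ?W" if "t \<in> {0..e}" for t
  proof -
    \<comment> \<open>At the exit time itself the curve is still in the chart: it is a limit of points of a
      compact, hence closed, set.\<close>
    have "compact ?W" using img by (intro compact_chart_inv_image[OF S]) auto
    then have "closed ({0..e} \<inter> \<gamma> -` ?W)"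
      using cont e01 by (intro continuous_closed_preimage compact_imp_closed)
        (auto intro: continuous_on_subset)
    moreover have "{0<..<e} \<subseteq> {0..e} \<inter> \<gamma> -` ?W"
    proof
      fix t assume t: "t \<in> {0<..<e}"
      then have "\<gamma> t \<in> ?V" by (intro before) auto
      moreover have "?V \<subseteq> ?W" by (intro image_mono ball_subset_cball)
      ultimately have "\<gamma> t \<in> ?W" by (rule subsetD[rotated])
      with t show "t \<in> {0..e} \<inter> \<gamma> -` ?W" by auto
    qed
    ultimately have "closure {0<..<e} \<subseteq> {0..e} \<inter> \<gamma> -` ?W" by (rule closure_minimal[rotated])
    moreover have "t \<in> closure {0<..<e}" using that \<open>e > 0\<close> by simp
    ultimately show ?thesis by blast
  qed
  define h where "h = chart_map S i \<circ> \<gamma>"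
  have h_cball: "h t \<in> cball u \<rho>" and \<gamma>_h: "\<gamma> t = chart_inv S i (h t)"
    and dom: "\<gamma> t \<in> chart_dom S i" if "t \<in> {0..e}" for t
  proof -
    from that have "\<gamma> t \<in> ?W" by (rule inW)
    then obtain y where y: "\<gamma> t = chart_inv S i y" "y \<in> cball u \<rho>" by (rule imageE)
    have img_y: "y \<in> chart_img S i" using y(2) img by (rule subsetD[rotated])
    then have "h t = y" using chart_map_inv[OF S, of y i] y(1) by (simp add: h_def)
    with y show "h t \<in> cball u \<rho>" "\<gamma> t = chart_inv S i (h t)" by simp_all
    show "\<gamma> t \<in> chart_dom S i" using chart_inv_in_dom[OF S img_y] y(1) by simp
  qed
  have "u \<in> chart_img S i" using img \<open>\<rho> > 0\<close> by auto
  then have h0: "h 0 = u" using chart_map_inv[OF S] by (simp add: h_def start)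
  have he: "norm (h e - h 0) \<ge> \<rho>"
  proof (rule ccontr)
    assume "\<not> ?thesis"
    then have "h e \<in> ball u \<rho>" using h0 by (simp add: dist_norm norm_minus_commute)
    then have "\<gamma> e \<in> ?V" using \<gamma>_h[of e] e01 by auto
    then show False using e(1) K_iff by blast
  qed
  have conth: "continuous_on {0..e} h"
    unfolding h_def using e01 dom
    by (intro continuous_on_compose continuous_on_subset[OF cont]
        continuous_on_subset[OF continuous_on_chart_map[OF S]]) auto
  \<comment> \<open>The value 0 at the break points makes the bound by the speed valid at all times.\<close>
  define h' where "h' t = (if t \<in> {0<..<e} - T then vector_derivative h (at t) else 0)" for t
  have h': "(h has_vector_derivative h' t) (at t) \<and> c * norm (h' t) \<le> speed S \<gamma> t"
    if t: "t \<in> {0<..<e} - T" for t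
  proof -
    have "t \<in> {0<..<1} - T" "\<gamma> t \<in> chart_dom S i" using t e01 dom by auto
    then obtain w where w: "(h has_vector_derivative w) (at t)"
      "speed S \<gamma> t = tangent_norm S i (\<gamma> t) w"
      using curve_has_velocity[OF R cont sub T] unfolding h_def by blast
    moreover have "h' t = w" using t w(1) by (simp add: h'_def vector_derivative_at)
    moreover have "h t \<in> cball u \<rho>" "\<gamma> t = chart_inv S i (h t)"
      using h_cball[of t] \<gamma>_h[of t] t by auto
    ultimately show ?thesis using bound by simp
  qed
  have FTC: "(h' has_integral (h e - h 0)) {0..e}"
    using h' \<open>e > 0\<close> conth by (intro fundamental_theorem_of_calculus_interior_strong[OF T(1)]) auto
  have int: "speed S \<gamma> integrable_on {0..1}" by (rule speed_integrable[OF R \<gamma>])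
  then have int_e: "speed S \<gamma> integrable_on {0..e}"
    using e01 by (auto intro: integrable_on_subinterval)
  have nonneg: "speed S \<gamma> t \<ge> 0" if "t \<in> {0..1}" for t
    using sub that by (intro speed_nonneg[OF R]) auto
  have "c * \<rho> \<le> c * norm (integral {0..e} h')"
    using he FTC \<open>c > 0\<close> by (simp add: integral_unique)
  also have "norm (integral {0..e} h') \<le> integral {0..e} (\<lambda>t. speed S \<gamma> t / c)"
  proof (rule integral_norm_bound_integral)
    show "h' integrable_on {0..e}" using FTC by blast
    show "(\<lambda>t. speed S \<gamma> t / c) integrable_on {0..e}"
      using int_e by (rule integrable_on_divide)
    fix t assume t: "t \<in> {0..e}"
    show "norm (h' t) \<le> speed S \<gamma> t / c"
      using h'[of t] nonneg[of t] t e01 \<open>c > 0\<close>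
      by (cases "t \<in> {0<..<e} - T") (auto simp: h'_def field_simps)
  qed
  also have "c * integral {0..e} (\<lambda>t. speed S \<gamma> t / c) = integral {0..e} (speed S \<gamma>)"
    using \<open>c > 0\<close> by simp
  also have "\<dots> \<le> integral {0..1} (speed S \<gamma>)"
    using int int_e e01 nonneg by (intro integral_subset_le) auto
  finally show ?thesis
    using \<open>c > 0\<close> by (simp add: curve_length_def)
qed

lemma chart_segment_C1_curve:
  assumes seg: "closed_segment u (u + v) \<subseteq> chart_img S i"
  shows "piecewise_C1_curve S (\<lambda>t. chart_inv S i (u + t *\<^sub>R v))"
proof -
  note S = riemannian_smooth_manifold[OF R]
  let ?\<gamma> = "\<lambda>t. chart_inv S i (u + t *\<^sub>R v)"
  have img: "u + t *\<^sub>R v \<in> chart_img S i" if "t \<in> {0..1}" for t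
  proof -
    have "u + t *\<^sub>R v = (1 - t) *\<^sub>R u + t *\<^sub>R (u + v)" by (simp add: algebra_simps)
    then have "u + t *\<^sub>R v \<in> closed_segment u (u + v)"
      using that unfolding in_segment(1) by auto
    then show ?thesis using seg by blast
  qed
  have dom: "?\<gamma> t \<in> chart_dom S i" if "t \<in> {0..1}" for t
    using img[OF that] by (rule chart_inv_in_dom[OF S])
  have "continuous_on {0..1} ?\<gamma>"
    using img by (intro continuous_on_compose2[OF continuous_on_chart_inv[OF S]] continuous_intros) auto
  moreover have "?\<gamma> ` {0..1} \<subseteq> carrier S" using dom unfolding carrier_def by blast
  moreover have "C1_off S ?\<gamma> {}"
    unfolding C1_off_def
  proof (intro allI impI)
    fix j and s t :: real
    assume A: "0 \<le> s \<and> s < t \<and> t \<le> 1 \<and> {s<..<t} \<inter> {} = {} \<and> ?\<gamma> ` {s..t} \<subseteq> chart_dom S j"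
    let ?O = "chart_map S i ` (chart_dom S i \<inter> chart_dom S j)"
    have both: "?\<gamma> \<tau> \<in> chart_dom S i \<inter> chart_dom S j" "u + \<tau> *\<^sub>R v \<in> chart_img S i"
      if "\<tau> \<in> {s..t}" for \<tau>
      using dom[of \<tau>] img[of \<tau>] that A by auto
    then have inO: "u + \<tau> *\<^sub>R v \<in> ?O" if "\<tau> \<in> {s..t}" for \<tau>
      using that chart_map_inv[OF S] by (metis imageI)
    let ?F' = "\<lambda>\<tau>. transition_deriv S i j (?\<gamma> \<tau>) v"
    have cont': "continuous_on {s..t} ?F'"
      using inO by (intro continuous_on_compose2[OF continuous_on_transition_derivative[OF S]]
          continuous_intros) auto
    have deriv: "((chart_map S j \<circ> ?\<gamma>) has_vector_derivative ?F' \<tau>) (at \<tau> within {s..t})"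
      if \<tau>: "\<tau> \<in> {s..t}" for \<tau>
    proof -
      have D: "((chart_map S j \<circ> chart_inv S i) has_derivative transition_deriv S i j (?\<gamma> \<tau>))
          (at (u + \<tau> *\<^sub>R v))"
        using transition_has_derivative[OF S both(1)[OF \<tau>]] chart_map_inv[OF S both(2)[OF \<tau>]] by simp
      have "((\<lambda>\<tau>. u + \<tau> *\<^sub>R v) has_derivative (\<lambda>h. h *\<^sub>R v)) (at \<tau> within {s..t})"
        by (auto intro!: derivative_eq_intros)
      from has_derivative_compose[OF this D]
      have "((\<lambda>\<tau>. (chart_map S j \<circ> chart_inv S i) (u + \<tau> *\<^sub>R v)) has_derivative
          (\<lambda>h. transition_deriv S i j (?\<gamma> \<tau>) (h *\<^sub>R v))) (at \<tau> within {s..t})" .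
      then show ?thesis
        by (simp add: has_vector_derivative_def o_def linear_scale[OF has_derivative_linear[OF D]])
    qed
    have "s < t" using A by blast
    then show "Ck_on 1 {s..t} (chart_map S j \<circ> ?\<gamma>)"
      using cont' deriv by (simp only: C1_interval_iff) (intro exI[of _ ?F'], simp)
  qed
  ultimately show ?thesis
    unfolding piecewise_C1_curve_iff by blast
qed

lemma chart_segment_length_le:
  assumes seg: "closed_segment u (u + v) \<subseteq> chart_img S i"
    and B: "\<And>y. y \<in> closed_segment u (u + v) \<Longrightarrow> tangent_norm S i (chart_inv S i y) v \<le> B"
  shows "curve_length S (\<lambda>t. chart_inv S i (u + t *\<^sub>R v)) \<le> B"
proof -
  note S = riemannian_smooth_manifold[OF R]
  let ?\<gamma> = "\<lambda>t. chart_inv S i (u + t *\<^sub>R v)"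
  have in_seg: "u + t *\<^sub>R v \<in> closed_segment u (u + v)" if "t \<in> {0..1}" for t
  proof -
    have "u + t *\<^sub>R v = (1 - t) *\<^sub>R u + t *\<^sub>R (u + v)" by (simp add: algebra_simps)
    then show ?thesis
      using that unfolding in_segment(1) by auto
  qed
  have dom: "?\<gamma> t \<in> chart_dom S i" if "t \<in> {0..1}" for t
    using in_seg[OF that] seg by (intro chart_inv_in_dom[OF S]) auto
  have le: "speed S ?\<gamma> t \<le> B" if t: "t \<in> {0<..<1}" for t
  proof -
    have "((\<lambda>\<tau>. u + \<tau> *\<^sub>R v) has_vector_derivative v) (at t)"
      by (auto intro!: derivative_eq_intros)
    then have "((chart_map S i \<circ> ?\<gamma>) has_vector_derivative v) (at t)"
    proof (rule has_vector_derivative_transform_within_open[of _ _ _ "{0<..<1}"])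
      fix \<tau> :: real assume "\<tau> \<in> {0<..<1}"
      then show "u + \<tau> *\<^sub>R v = (chart_map S i \<circ> ?\<gamma>) \<tau>"
        using in_seg[of \<tau>] seg chart_map_inv[OF S, of "u + \<tau> *\<^sub>R v" i] by auto
    qed (use t in auto)
    then have "speed S ?\<gamma> t = tangent_norm S i (?\<gamma> t) v"
      using t dom by (intro speed_in_chart[OF R, of 0 t 1]) auto
    then show ?thesis using B in_seg[of t] t by auto
  qed
  have "(speed S ?\<gamma> has_integral curve_length S ?\<gamma>) {0..1}"
    unfolding curve_length_def
    by (intro integrable_integral speed_integrable[OF R] chart_segment_C1_curve seg)
  then have "((\<lambda>t. if t \<in> {0, 1} then B else speed S ?\<gamma> t) has_integral curve_length S ?\<gamma>) {0..1}"
    by (rule has_integral_spike_finite[of "{0, 1}", rotated 2]) auto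
  moreover have "((\<lambda>t. B) has_integral B) {0..1::real}"
    using has_integral_const_real[of B 0 1] by simp
  ultimately show ?thesis
    by (rule has_integral_le) (use le in auto)
qed

text \<open>
  For the reversal and the concatenation of curves. The hypothesis on \<open>F\<close> is local because a
  concatenation is an affine reparametrization on each half of the interval only.
\<close>

lemma speed_affine_reparametrization:
  assumes \<gamma>: "continuous_on {0..1} \<gamma>" "\<gamma> ` {0..1} \<subseteq> carrier S" "finite T" "C1_off S \<gamma> T"
    and t: "a < t" "t < b" and mt: "m * t + c \<in> {0<..<1} - T"
    and F: "\<And>\<tau>. a < \<tau> \<Longrightarrow> \<tau> < b \<Longrightarrow> F \<tau> = \<gamma> (m * \<tau> + c)"
  shows "speed S F t = \<bar>m\<bar> * speed S \<gamma> (m * t + c)"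
proof -
  define i where "i = chart_at S (F t)"
  have Ft: "F t = \<gamma> (m * t + c)" using F t by blast
  have "\<gamma> (m * t + c) \<in> carrier S" using \<gamma>(2) mt by auto
  then have i: "\<gamma> (m * t + c) \<in> chart_dom S i"
    unfolding i_def Ft by (rule chart_at_dom)
  obtain w where w: "((chart_map S i \<circ> \<gamma>) has_vector_derivative w) (at (m * t + c))"
    "speed S \<gamma> (m * t + c) = tangent_norm S i (\<gamma> (m * t + c)) w"
    using curve_has_velocity[OF R \<gamma> mt i] by blast
  have "((\<lambda>\<tau>. m * \<tau> + c) has_vector_derivative m) (at t)"
    by (auto intro!: derivative_eq_intros)
  from vector_diff_chain_at[OF this w(1)]
  have "(((chart_map S i \<circ> \<gamma>) \<circ> (\<lambda>\<tau>. m * \<tau> + c)) has_vector_derivative m *\<^sub>R w) (at t)" .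
  then have "((chart_map S i \<circ> F) has_vector_derivative m *\<^sub>R w) (at t)"
    by (rule has_vector_derivative_transform_within_open[of _ _ _ "{a<..<b}"]) (use F t in auto)
  then have "speed S F t = tangent_norm S i (F t) (m *\<^sub>R w)"
    by (simp add: speed_def Let_def tangent_norm_def vector_derivative_at flip: i_def)
  then show ?thesis
    using tangent_norm_scale[OF R i] w(2) Ft by simp
qed

end

section \<open>Concatenation and reversal of curves\<close>

context
  fixes S :: "('i, 'a::{t2_space, second_countable_topology}, 'e::euclidean_space) rmfd"
  assumes R: "riemannian_manifold S"
begin

lemma join_C1_curve:
  assumes g: "piecewise_C1_curve S g" and h: "piecewise_C1_curve S h" and gh: "g 1 = h 0"
  shows "piecewise_C1_curve S (g +++ h)"
    and "curve_length S (g +++ h) = curve_length S g + curve_length S h"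
proof -
  obtain T where G: "continuous_on {0..1} g" "g ` {0..1} \<subseteq> carrier S" "finite T" "C1_off S g T"
    using g by (auto simp: piecewise_C1_curve_iff)
  obtain U where H: "continuous_on {0..1} h" "h ` {0..1} \<subseteq> carrier S" "finite U" "C1_off S h U"
    using h by (auto simp: piecewise_C1_curve_iff)
  let ?F = "g +++ h"
  let ?V = "(\<lambda>t. t / 2) ` T \<union> {1 / 2} \<union> (\<lambda>t. (t + 1) / 2) ` U"
  have left: "?F t = g (2 * t)" if "t \<le> 1 / 2" for t
    using that by (simp add: joinpaths_def)
  have right: "?F t = h (2 * t - 1)" if "t \<ge> 1 / 2" for t
  proof (cases "t = 1 / 2")
    case True
    show ?thesis unfolding True joinpaths_def using gh by simp
  qed (use that in \<open>simp add: joinpaths_def\<close>)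
  have "path ?F"
    using G(1) H(1) gh by (intro path_join_imp) (auto simp: path_def pathfinish_def pathstart_def)
  moreover have "?F ` {0..1} \<subseteq> carrier S"
    using path_image_join_subset[of g h] G(2) H(2) unfolding path_image_def by blast
  moreover have "C1_off S ?F ?V"
    unfolding C1_off_def
  proof (intro allI impI)
    fix i and s t :: real
    assume A: "0 \<le> s \<and> s < t \<and> t \<le> 1 \<and> {s<..<t} \<inter> ?V = {} \<and> ?F ` {s..t} \<subseteq> chart_dom S i"
    then have "1 / 2 \<notin> {s<..<t}" by blast
    then consider "t \<le> 1 / 2" | "s \<ge> 1 / 2" by fastforce
    then show "Ck_on 1 {s..t} (chart_map S i \<circ> ?F)"
    proof cases
      case 1
      have "{2 * s<..<2 * t} \<inter> T = {}"
      proof (rule ccontr)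
        assume "\<not> ?thesis"
        then obtain \<tau> where "\<tau> \<in> {2 * s<..<2 * t}" "\<tau> \<in> T" by blast
        then have "\<tau> / 2 \<in> {s<..<t}" "\<tau> / 2 \<in> ?V" by auto
        with A show False by blast
      qed
      moreover have "g ` {2 * s..2 * t} \<subseteq> chart_dom S i"
      proof
        fix p assume "p \<in> g ` {2 * s..2 * t}"
        then obtain \<tau> where \<tau>: "\<tau> \<in> {2 * s..2 * t}" "p = g \<tau>" by blast
        then have "p = ?F (\<tau> / 2)" "\<tau> / 2 \<in> {s..t}" using left[of "\<tau> / 2"] 1 by auto
        with A show "p \<in> chart_dom S i" by blast
      qed
      ultimately have "Ck_on 1 {2 * s..2 * t} (chart_map S i \<circ> g)"
        using A 1 by (intro C1_offD[OF G(4)]) auto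
      then show ?thesis
        by (rule C1_affine_reparametrization[of _ _ _ 2 s t 0]) (use A 1 left in auto)
    next
      case 2
      have "{2 * s - 1<..<2 * t - 1} \<inter> U = {}"
      proof (rule ccontr)
        assume "\<not> ?thesis"
        then obtain \<tau> where "\<tau> \<in> {2 * s - 1<..<2 * t - 1}" "\<tau> \<in> U" by blast
        then have "(\<tau> + 1) / 2 \<in> {s<..<t}" "(\<tau> + 1) / 2 \<in> ?V" by auto
        with A show False by blast
      qed
      moreover have "h ` {2 * s - 1..2 * t - 1} \<subseteq> chart_dom S i"
      proof
        fix p assume "p \<in> h ` {2 * s - 1..2 * t - 1}"
        then obtain \<tau> where \<tau>: "\<tau> \<in> {2 * s - 1..2 * t - 1}" "p = h \<tau>" by blast
        then have "p = ?F ((\<tau> + 1) / 2)" "(\<tau> + 1) / 2 \<in> {s..t}"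
          using right[of "(\<tau> + 1) / 2"] 2 by (auto simp: field_simps)
        with A show "p \<in> chart_dom S i" by blast
      qed
      ultimately have "Ck_on 1 {2 * s - 1..2 * t - 1} (chart_map S i \<circ> h)"
        using A 2 by (intro C1_offD[OF H(4)]) auto
      then show ?thesis
        by (rule C1_affine_reparametrization[of _ _ _ 2 s t "-1"]) (use A 2 right in auto)
    qed
  qed
  moreover have "finite ?V" using G(3) H(3) by simp
  ultimately show "piecewise_C1_curve S ?F"
    unfolding piecewise_C1_curve_iff path_def by (intro conjI exI[of _ ?V])
  have int: "(speed S \<gamma> has_integral curve_length S \<gamma>) {0..1}" if "piecewise_C1_curve S \<gamma>" for \<gamma>
    unfolding curve_length_def by (intro integrable_integral speed_integrable[OF R that])
  have "((\<lambda>t. 2 * speed S g (2 * t)) has_integral curve_length S g) {0..1/2}"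
    using has_integral_mult_right[OF has_integral_affinity'[of "speed S g" "curve_length S g" 0 1 2 0], of 2]
      int[OF g] by simp
  then have "(speed S ?F has_integral curve_length S g) {0..1/2}"
  proof (rule has_integral_spike_finite[of "{0, 1/2} \<union> ?V", rotated 2])
    fix t :: real assume t: "t \<in> {0..1/2} - ({0, 1/2} \<union> ?V)"
    have "2 * t \<notin> T"
    proof
      assume "2 * t \<in> T"
      then have "2 * t / 2 \<in> ?V" by blast
      with t show False by simp
    qed
    then show "speed S ?F t = 2 * speed S g (2 * t)"
      using t left speed_affine_reparametrization[OF R G, of 0 t "1/2" 2 0 ?F] by auto
  qed (use \<open>finite ?V\<close> in auto)
  moreover have "((\<lambda>t. 2 * speed S h (2 * t - 1)) has_integral curve_length S h) {1/2..1}"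
    using has_integral_mult_right[OF has_integral_affinity'[of "speed S h" "curve_length S h" 0 1 2 "-1"], of 2]
      int[OF h] by simp
  then have "(speed S ?F has_integral curve_length S h) {1/2..1}"
  proof (rule has_integral_spike_finite[of "{1/2, 1} \<union> ?V", rotated 2])
    fix t :: real assume t: "t \<in> {1/2..1} - ({1/2, 1} \<union> ?V)"
    have "2 * t - 1 \<notin> U"
    proof
      assume "2 * t - 1 \<in> U"
      then have "(2 * t - 1 + 1) / 2 \<in> ?V" by blast
      with t show False by simp
    qed
    then show "speed S ?F t = 2 * speed S h (2 * t - 1)"
      using t right speed_affine_reparametrization[OF R H, of "1/2" t 1 2 "-1" ?F] by auto
  qed (use \<open>finite ?V\<close> in auto)
  ultimately have "(speed S ?F has_integral curve_length S g + curve_length S h) {0..1}"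
    by (intro has_integral_combine[of 0 "1/2" 1]) auto
  then show "curve_length S ?F = curve_length S g + curve_length S h"
    unfolding curve_length_def[of S ?F] by (rule integral_unique)
qed

lemma reverse_C1_curve:
  assumes g: "piecewise_C1_curve S g"
  shows "piecewise_C1_curve S (reversepath g)"
    and "curve_length S (reversepath g) = curve_length S g"
proof -
  obtain T where G: "continuous_on {0..1} g" "g ` {0..1} \<subseteq> carrier S" "finite T" "C1_off S g T"
    using g by (auto simp: piecewise_C1_curve_iff)
  let ?F = "reversepath g" and ?V = "(\<lambda>t. 1 - t) ` T"
  have F: "?F t = g (-1 * t + 1)" for t by (simp add: reversepath_def)
  have "path ?F" using G(1) unfolding path_def[symmetric] by simp
  moreover have "?F ` {0..1} \<subseteq> carrier S"
    using path_image_reversepath[of g] G(2) unfolding path_image_def by blast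
  moreover have "C1_off S ?F ?V"
    unfolding C1_off_def
  proof (intro allI impI)
    fix i and s t :: real
    assume A: "0 \<le> s \<and> s < t \<and> t \<le> 1 \<and> {s<..<t} \<inter> ?V = {} \<and> ?F ` {s..t} \<subseteq> chart_dom S i"
    have "{1 - t<..<1 - s} \<inter> T = {}"
    proof (rule ccontr)
      assume "\<not> ?thesis"
      then obtain \<tau> where "\<tau> \<in> {1 - t<..<1 - s}" "\<tau> \<in> T" by blast
      then have "1 - \<tau> \<in> {s<..<t}" "1 - \<tau> \<in> ?V" by auto
      with A show False by blast
    qed
    moreover have "g ` {1 - t..1 - s} \<subseteq> chart_dom S i"
    proof
      fix p assume "p \<in> g ` {1 - t..1 - s}"
      then obtain \<tau> where \<tau>: "\<tau> \<in> {1 - t..1 - s}" "p = g \<tau>" by blast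
      then have "p = ?F (1 - \<tau>)" "1 - \<tau> \<in> {s..t}" using F[of "1 - \<tau>"] by auto
      with A show "p \<in> chart_dom S i" by blast
    qed
    ultimately have "Ck_on 1 {1 - t..1 - s} (chart_map S i \<circ> g)"
      using A by (intro C1_offD[OF G(4)]) auto
    then show "Ck_on 1 {s..t} (chart_map S i \<circ> ?F)"
      by (rule C1_affine_reparametrization[of _ _ _ "-1" s t 1]) (use A F in auto)
  qed
  moreover have "finite ?V" using G(3) by simp
  ultimately show "piecewise_C1_curve S ?F"
    unfolding piecewise_C1_curve_iff path_def by (intro conjI exI[of _ ?V])
  have "(speed S g has_integral curve_length S g) (cbox 0 1)"
    unfolding curve_length_def using speed_integrable[OF R g] by (simp add: integrable_integral)
  from has_integral_affinity[OF this, of "-1" 1]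
  have "((\<lambda>t. speed S g (-1 * t + 1)) has_integral curve_length S g) {0..1}"
    by (simp add: image_affinity_atLeastAtMost)
  then have "(speed S ?F has_integral curve_length S g) {0..1}"
  proof (rule has_integral_spike_finite[of "{0, 1} \<union> ?V", rotated 2])
    fix t :: real assume t: "t \<in> {0..1} - ({0, 1} \<union> ?V)"
    have "1 - t \<notin> T"
    proof
      assume "1 - t \<in> T"
      then have "1 - (1 - t) \<in> ?V" by blast
      with t show False by simp
    qed
    then show "speed S ?F t = speed S g (-1 * t + 1)"
      using t F speed_affine_reparametrization[OF R G, of 0 t 1 "-1" 1 ?F] by auto
  qed (use \<open>finite ?V\<close> in auto)
  then show "curve_length S ?F = curve_length S g"
    unfolding curve_length_def[of S ?F] by (rule integral_unique)
qed

section \<open>The Riemannian distance\<close>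

lemma riem_dist_le_length:
  assumes \<gamma>: "piecewise_C1_curve S \<gamma>"
  shows "riem_dist S (\<gamma> 0) (\<gamma> 1) \<le> curve_length S \<gamma>"
proof -
  have "\<gamma> 0 \<in> carrier S" "\<gamma> 1 \<in> carrier S"
    using \<gamma> by (auto simp: piecewise_C1_curve_def)
  moreover have "bdd_below {curve_length S \<eta> |\<eta>. piecewise_C1_curve S \<eta> \<and> \<eta> 0 = \<gamma> 0 \<and> \<eta> 1 = \<gamma> 1}"
    using curve_length_nonneg[OF R] by (intro bdd_belowI[of _ 0]) blast
  ultimately show ?thesis
    unfolding riem_dist_def using \<gamma> by (auto intro!: cInf_lower)
qed

lemma riem_dist_chart_segment_le:
  assumes "closed_segment u (u + v) \<subseteq> chart_img S i"
    and "\<And>y. y \<in> closed_segment u (u + v) \<Longrightarrow> tangent_norm S i (chart_inv S i y) v \<le> B"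
  shows "riem_dist S (chart_inv S i u) (chart_inv S i (u + v)) \<le> B"
  using riem_dist_le_length[OF chart_segment_C1_curve[OF R assms(1)]]
    chart_segment_length_le[OF R assms] by simp

context
  assumes conn: "connected (carrier S)"
begin

text \<open>
  Being joined by a curve is an equivalence relation with open classes, as chart balls are convex.
  Without it the infimum that defines the distance could be taken over the empty set.
\<close>

lemma C1_curve_exists:
  assumes "p \<in> carrier S" "q \<in> carrier S"
  shows "\<exists>\<gamma>. piecewise_C1_curve S \<gamma> \<and> \<gamma> 0 = p \<and> \<gamma> 1 = q"
  using conn assms
proof (rule connected_equivalence_relation)
  note S = riemannian_smooth_manifold[OF R]
  fix p q r :: 'a
  show "\<exists>\<gamma>. piecewise_C1_curve S \<gamma> \<and> \<gamma> 0 = q \<and> \<gamma> 1 = p"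
    if pq: "\<exists>\<gamma>. piecewise_C1_curve S \<gamma> \<and> \<gamma> 0 = p \<and> \<gamma> 1 = q"
  proof -
    obtain \<gamma> where "piecewise_C1_curve S \<gamma>" "\<gamma> 0 = p" "\<gamma> 1 = q" using pq by blast
    then show ?thesis
      by (intro exI[of _ "reversepath \<gamma>"]) (simp add: reverse_C1_curve, simp add: reversepath_def)
  qed
  show "\<exists>\<gamma>. piecewise_C1_curve S \<gamma> \<and> \<gamma> 0 = p \<and> \<gamma> 1 = r"
    if pq: "\<exists>\<gamma>. piecewise_C1_curve S \<gamma> \<and> \<gamma> 0 = p \<and> \<gamma> 1 = q"
      and qr: "\<exists>\<gamma>. piecewise_C1_curve S \<gamma> \<and> \<gamma> 0 = q \<and> \<gamma> 1 = r"
  proof -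
    obtain \<gamma> where "piecewise_C1_curve S \<gamma>" "\<gamma> 0 = p" "\<gamma> 1 = q" using pq by blast
    moreover obtain \<eta> where "piecewise_C1_curve S \<eta>" "\<eta> 0 = q" "\<eta> 1 = r" using qr by blast
    ultimately show ?thesis
      by (intro exI[of _ "\<gamma> +++ \<eta>"]) (simp add: join_C1_curve, simp add: joinpaths_def)
  qed
  fix a assume "a \<in> carrier S"
  then obtain i where i: "a \<in> chart_dom S i" by (auto simp: carrier_def)
  obtain r where r: "r > 0" "cball (chart_map S i a) r \<subseteq> chart_img S i"
    using chart_ball_exists[OF S i] by blast
  let ?u = "chart_map S i a"
  let ?V = "chart_inv S i ` ball ?u r"
  have "ball ?u r \<subseteq> chart_img S i" using r(2) ball_subset_cball by (rule subset_trans[rotated])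
  then have "openin (top_of_set (carrier S)) ?V"
    by (intro openin_chart_inv_image[OF S]) auto
  moreover have "a \<in> ?V"
    using r(1) chart_inv_map[OF S i] by (intro image_eqI[of _ _ ?u]) auto
  moreover have "\<exists>\<gamma>. piecewise_C1_curve S \<gamma> \<and> \<gamma> 0 = a \<and> \<gamma> 1 = q" if "q \<in> ?V" for q
  proof -
    from that obtain y where y: "q = chart_inv S i y" "y \<in> ball ?u r" by (rule imageE)
    have "closed_segment ?u y \<subseteq> cball ?u r"
      using y(2) r(1) by (intro closed_segment_subset) auto
    then have "closed_segment ?u (?u + (y - ?u)) \<subseteq> chart_img S i" using r(2) by simp
    from chart_segment_C1_curve[OF R this] show ?thesis
      by (rule_tac exI, intro conjI, assumption) (simp_all add: chart_inv_map[OF S i] y(1))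
  qed
  ultimately show "\<exists>T. openin (top_of_set (carrier S)) T \<and> a \<in> T \<and>
      (\<forall>q\<in>T. \<exists>\<gamma>. piecewise_C1_curve S \<gamma> \<and> \<gamma> 0 = a \<and> \<gamma> 1 = q)"
    by (intro exI[of _ ?V]) simp
qed

lemma riem_dist_curve:
  assumes p: "p \<in> carrier S" and q: "q \<in> carrier S" and less: "riem_dist S p q < B"
  obtains \<gamma> where "piecewise_C1_curve S \<gamma>" "\<gamma> 0 = p" "\<gamma> 1 = q" "curve_length S \<gamma> < B"
proof -
  let ?L = "{curve_length S \<gamma> |\<gamma>. piecewise_C1_curve S \<gamma> \<and> \<gamma> 0 = p \<and> \<gamma> 1 = q}"
  have "?L \<noteq> {}" using C1_curve_exists[OF p q] by blast
  moreover have "Inf ?L < B" using less p q by (simp add: riem_dist_def)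
  ultimately have "\<exists>l\<in>?L. l < B" by (rule cInf_lessD)
  then show thesis using that by blast
qed

lemma riem_dist_nonneg: "riem_dist S p q \<ge> 0"
proof (cases "p \<in> carrier S \<and> q \<in> carrier S")
  case True
  show ?thesis
  proof (rule ccontr)
    assume "\<not> ?thesis"
    then obtain \<gamma> where "piecewise_C1_curve S \<gamma>" "curve_length S \<gamma> < 0"
      using riem_dist_curve[of p q 0] True by auto
    then show False using curve_length_nonneg[OF R] by fastforce
  qed
qed (auto simp: riem_dist_def)

lemma riem_dist_commute: "riem_dist S p q = riem_dist S q p"
proof (cases "p \<in> carrier S \<and> q \<in> carrier S")
  case True
  have le: "riem_dist S b a \<le> riem_dist S a b" if ab: "a \<in> carrier S" "b \<in> carrier S" for a b
  proof (rule dense_ge)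
    fix B assume "riem_dist S a b < B"
    then obtain \<gamma> where \<gamma>: "piecewise_C1_curve S \<gamma>" "\<gamma> 0 = a" "\<gamma> 1 = b" "curve_length S \<gamma> < B"
      using riem_dist_curve[OF ab] by blast
    have "riem_dist S (reversepath \<gamma> 0) (reversepath \<gamma> 1) \<le> curve_length S (reversepath \<gamma>)"
      using \<gamma>(1) by (intro riem_dist_le_length reverse_C1_curve)
    then show "riem_dist S b a \<le> B"
      using \<gamma> by (simp add: reverse_C1_curve) (simp add: reversepath_def)
  qed
  then show ?thesis using True by (intro antisym) auto
qed (auto simp: riem_dist_def)

lemma riem_dist_triangle:
  assumes "p \<in> carrier S" "q \<in> carrier S" "r \<in> carrier S"
  shows "riem_dist S p r \<le> riem_dist S p q + riem_dist S q r"
proof (rule field_le_epsilon)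
  fix e :: real assume "e > 0"
  obtain \<gamma> where \<gamma>: "piecewise_C1_curve S \<gamma>" "\<gamma> 0 = p" "\<gamma> 1 = q"
    "curve_length S \<gamma> < riem_dist S p q + e / 2"
    using riem_dist_curve[OF assms(1,2), of "riem_dist S p q + e / 2"] \<open>e > 0\<close> by auto
  obtain \<eta> where \<eta>: "piecewise_C1_curve S \<eta>" "\<eta> 0 = q" "\<eta> 1 = r"
    "curve_length S \<eta> < riem_dist S q r + e / 2"
    using riem_dist_curve[OF assms(2,3), of "riem_dist S q r + e / 2"] \<open>e > 0\<close> by auto
  have "\<gamma> 1 = \<eta> 0" using \<gamma> \<eta> by simp
  note join = join_C1_curve[OF \<gamma>(1) \<eta>(1) this]
  have "(\<gamma> +++ \<eta>) 0 = p" "(\<gamma> +++ \<eta>) 1 = r" using \<gamma> \<eta> by (auto simp: joinpaths_def)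
  then have "riem_dist S p r \<le> curve_length S \<gamma> + curve_length S \<eta>"
    using riem_dist_le_length[OF join(1)] join(2) by simp
  then show "riem_dist S p r \<le> riem_dist S p q + riem_dist S q r + e"
    using \<gamma>(4) \<eta>(4) by simp
qed

text \<open>
  The constant serves all radii \<open>\<rho>\<close> at once. This is what the separation of points needs, where
  the radius is dictated by the second point.
\<close>

lemma riem_dist_outside_chart_ball:
  assumes i: "p \<in> chart_dom S i"
    and r: "cball (chart_map S i p) r \<subseteq> chart_img S i"
  obtains c where "c > 0" "\<And>\<rho> q. 0 < \<rho> \<Longrightarrow> \<rho> \<le> r \<Longrightarrow> q \<in> carrier S \<Longrightarrow>
    q \<notin> chart_inv S i ` ball (chart_map S i p) \<rho> \<Longrightarrow> c * \<rho> \<le> riem_dist S p q"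
proof -
  note S = riemannian_smooth_manifold[OF R]
  let ?u = "chart_map S i p"
  have p: "p \<in> carrier S" using i unfolding carrier_def by blast
  obtain c where "c > 0"
    and c: "\<And>y v. y \<in> cball ?u r \<Longrightarrow> c * norm v \<le> tangent_norm S i (chart_inv S i y) v"
    using tangent_norm_bounds[OF R compact_cball r] by metis
  show thesis
  proof (rule that[OF \<open>c > 0\<close>])
    fix \<rho> q assume \<rho>: "0 < \<rho>" "\<rho> \<le> r" and q: "q \<in> carrier S" "q \<notin> chart_inv S i ` ball ?u \<rho>"
    have sub: "cball ?u \<rho> \<subseteq> cball ?u r" using \<rho> by auto
    show "c * \<rho> \<le> riem_dist S p q"
    proof (rule dense_ge)
      fix B assume "riem_dist S p q < B"
      then obtain \<gamma> where \<gamma>: "piecewise_C1_curve S \<gamma>" "\<gamma> 0 = p" "\<gamma> 1 = q" "curve_length S \<gamma> < B"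
        using riem_dist_curve[OF p q(1)] by blast
      have "c * \<rho> \<le> curve_length S \<gamma>"
      proof (rule curve_length_escape[OF R \<gamma>(1) \<rho>(1) \<open>c > 0\<close>])
        show "cball ?u \<rho> \<subseteq> chart_img S i" using sub r by (rule subset_trans)
        show "\<gamma> 0 = chart_inv S i ?u" using \<gamma>(2) chart_inv_map[OF S i] by simp
        show "\<gamma> 1 \<notin> chart_inv S i ` ball ?u \<rho>" using \<gamma>(3) q(2) by simp
      qed (use c sub in blast)
      then show "c * \<rho> \<le> B" using \<gamma>(4) by simp
    qed
  qed
qed

lemma riem_dist_zero_iff:
  assumes p: "p \<in> carrier S" and q: "q \<in> carrier S"
  shows "riem_dist S p q = 0 \<longleftrightarrow> p = q"
proof
  note S = riemannian_smooth_manifold[OF R]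
  obtain i where i: "p \<in> chart_dom S i" using p by (auto simp: carrier_def)
  let ?u = "chart_map S i p"
  obtain r where r: "r > 0" "cball ?u r \<subseteq> chart_img S i"
    using chart_ball_exists[OF S i] by blast
  obtain c where c: "c > 0" "\<And>\<rho> q. 0 < \<rho> \<Longrightarrow> \<rho> \<le> r \<Longrightarrow> q \<in> carrier S \<Longrightarrow>
      q \<notin> chart_inv S i ` ball ?u \<rho> \<Longrightarrow> c * \<rho> \<le> riem_dist S p q"
    using riem_dist_outside_chart_ball[OF i r(2)] by blast
  show "p = q" if "riem_dist S p q = 0"
  proof (rule ccontr)
    assume "p \<noteq> q"
    \<comment> \<open>If \<open>q\<close> is in the ball, the coordinate distance from \<open>p\<close> to \<open>q\<close> is such a radius.\<close>
    have "\<exists>\<rho>. 0 < \<rho> \<and> \<rho> \<le> r \<and> q \<notin> chart_inv S i ` ball ?u \<rho>"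
    proof (cases "q \<in> chart_inv S i ` ball ?u r")
      case False
      then show ?thesis using r(1) by blast
    next
      case True
      then obtain y where y: "q = chart_inv S i y" "y \<in> ball ?u r" by (rule imageE)
      have img: "ball ?u r \<subseteq> chart_img S i"
        using r(2) ball_subset_cball by (rule subset_trans[rotated])
      have "y \<noteq> ?u" using y(1) \<open>p \<noteq> q\<close> chart_inv_map[OF S i] by auto
      moreover have "q \<notin> chart_inv S i ` ball ?u (dist ?u y)"
      proof
        assume "q \<in> chart_inv S i ` ball ?u (dist ?u y)"
        then obtain z where z: "q = chart_inv S i z" "z \<in> ball ?u (dist ?u y)" by (rule imageE)
        have "z \<in> ball ?u r" using z(2) y(2) unfolding mem_ball by (rule less_trans)
        then have "z \<in> chart_img S i" by (rule subsetD[OF img])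
        moreover have "y \<in> chart_img S i" using y(2) by (rule subsetD[OF img])
        moreover have "chart_inv S i z = chart_inv S i y" using z(1) y(1) by (rule trans[OF sym])
        ultimately have "z = y" using chart_map_inv[OF S, of z i] chart_map_inv[OF S, of y i] by metis
        then show False using z(2) by simp
      qed
      ultimately show ?thesis using y(2) by (intro exI[of _ "dist ?u y"]) auto
    qed
    then obtain \<rho> where "0 < \<rho>" "c * \<rho> \<le> riem_dist S p q" using c(2) q by blast
    then show False using that c(1) by (simp add: mult_le_0_iff)
  qed
  show "riem_dist S p q = 0" if "p = q"
  proof -
    have "?u \<in> chart_img S i" using i by (rule chart_map_in_img[OF S])
    then have "riem_dist S (chart_inv S i ?u) (chart_inv S i (?u + 0)) \<le> 0"
      using tangent_norm_scale[OF R, of "chart_inv S i ?u" i 0 0] chart_inv_map[OF S i] i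
      by (intro riem_dist_chart_segment_le) auto
    then show ?thesis
      using riem_dist_nonneg[of p p] unfolding that[symmetric] by (simp add: chart_inv_map[OF S i])
  qed
qed

theorem riem_dist_metric: "Metric_space (carrier S) (riem_dist S)"
  by (intro Metric_space.intro riem_dist_nonneg riem_dist_commute riem_dist_zero_iff
      riem_dist_triangle)

text \<open>
  This turns semicontinuity on the manifold into semicontinuity for the distance, which is what
  the variational principle asks for.
\<close>

lemma openin_metric_topology:
  assumes U: "openin (top_of_set (carrier S)) U"
  shows "openin (Metric_space.mtopology (carrier S) (riem_dist S)) U"
proof -
  interpret Metric_space "carrier S" "riem_dist S" by (rule riem_dist_metric)
  note S = riemannian_smooth_manifold[OF R]
  have sub: "U \<subseteq> carrier S" using U by (rule openin_imp_subset)
  have "\<exists>\<epsilon>>0. mball p \<epsilon> \<subseteq> U" if "p \<in> U" for p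
  proof -
    have "p \<in> carrier S" using that sub by blast
    then obtain i where i: "p \<in> chart_dom S i" by (auto simp: carrier_def)
    let ?u = "chart_map S i p"
    have "open (chart_map S i ` (chart_dom S i \<inter> U))"
      using U by (intro open_chart_map_image[OF S] openin_Int openin_chart_dom[OF S]) auto
    moreover have "?u \<in> chart_map S i ` (chart_dom S i \<inter> U)" using i that by blast
    ultimately obtain r where r: "r > 0" "cball ?u r \<subseteq> chart_map S i ` (chart_dom S i \<inter> U)"
      using open_contains_cball by metis
    then have img: "cball ?u r \<subseteq> chart_img S i" unfolding chart_img_def by blast
    obtain c where c: "c > 0" "\<And>\<rho> q. 0 < \<rho> \<Longrightarrow> \<rho> \<le> r \<Longrightarrow> q \<in> carrier S \<Longrightarrow>
        q \<notin> chart_inv S i ` ball ?u \<rho> \<Longrightarrow> c * \<rho> \<le> riem_dist S p q"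
      using riem_dist_outside_chart_ball[OF i img] by blast
    have "mball p (c * r) \<subseteq> U"
    proof
      fix q assume "q \<in> mball p (c * r)"
      then have "q \<in> chart_inv S i ` ball ?u r"
        using c(2)[of r q] r(1) by fastforce
      then obtain y where y: "q = chart_inv S i y" "y \<in> ball ?u r" by (rule imageE)
      then have "y \<in> chart_map S i ` (chart_dom S i \<inter> U)" using r(2) by auto
      then show "q \<in> U" using chart_inv_map[OF S] y(1) by auto
    qed
    then show ?thesis using c(1) r(1) by (intro exI[of _ "c * r"]) simp
  qed
  then show ?thesis using sub by (simp add: openin_mtopology)
qed

end

end

section \<open>The variational principle of Ekeland\<close>

text \<open>
  The relation \<open>q \<in> A p\<close>, i.e. \<open>\<phi> q + \<epsilon> * d p q \<le> \<phi> p\<close>, is a preorder, and a minimal element is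
  sought. A sequence descends in it by choosing each time an almost minimal value of \<open>\<phi>\<close> among the
  elements still available. The total drop of \<open>\<phi>\<close> bounds the lengths of the steps, so the sequence
  is Cauchy, and its limit is minimal because no drop of \<open>\<phi>\<close> is left below it.
\<close>

lemma (in Metric_space) ekeland_variational_principle:
  fixes \<phi> :: "'a \<Rightarrow> real"
  assumes complete: mcomplete and "\<epsilon> > 0" and p0: "p0 \<in> M"
    and bdd: "\<And>p. p \<in> M \<Longrightarrow> b \<le> \<phi> p"
    and lsc: "\<And>a. closedin mtopology {p \<in> M. \<phi> p \<le> a}"
  obtains p where "p \<in> M" "\<phi> p \<le> \<phi> p0" "\<And>q. q \<in> M \<Longrightarrow> \<phi> q + \<epsilon> * d p q \<le> \<phi> p \<Longrightarrow> q = p"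
proof -
  define A where "A p = {q \<in> M. \<phi> q + \<epsilon> * d p q \<le> \<phi> p}" for p
  have A_refl: "p \<in> A p" if "p \<in> M" for p
    using that by (simp add: A_def)
  have A_trans: "r \<in> A p" if "q \<in> A p" "r \<in> A q" "p \<in> M" for p q r
  proof -
    have "d p r \<le> d p q + d q r" using that by (intro triangle) (auto simp: A_def)
    then have "\<epsilon> * d p r \<le> \<epsilon> * d p q + \<epsilon> * d q r"
      using \<open>\<epsilon> > 0\<close> by (simp flip: distrib_left)
    with that show ?thesis by (simp add: A_def)
  qed
  have near_inf: "\<exists>q. q \<in> A p \<and> (\<forall>r\<in>A p. \<phi> q \<le> \<phi> r + (1/2) ^ n)" if p: "p \<in> M" for p n
  proof -
    have bddA: "bdd_below (\<phi> ` A p)" using bdd by (auto intro!: bdd_belowI[of _ b] simp: A_def)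
    have ne: "\<phi> ` A p \<noteq> {}" using A_refl[OF p] by blast
    have "Inf (\<phi> ` A p) < Inf (\<phi> ` A p) + (1/2) ^ n" by simp
    then obtain q where q: "q \<in> A p" "\<phi> q < Inf (\<phi> ` A p) + (1/2) ^ n"
      using cInf_lessD[OF ne] by blast
    have "\<phi> q \<le> \<phi> r + (1/2) ^ n" if "r \<in> A p" for r
      using cInf_lower[OF imageI[OF that] bddA] q(2) by linarith
    with q(1) show ?thesis by blast
  qed
  have "\<exists>\<sigma>. \<forall>n. (\<sigma> n \<in> M \<and> (n = 0 \<longrightarrow> \<sigma> n = p0)) \<and>
      (\<sigma> (Suc n) \<in> A (\<sigma> n) \<and> (\<forall>r\<in>A (\<sigma> n). \<phi> (\<sigma> (Suc n)) \<le> \<phi> r + (1/2) ^ n))"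
  proof (rule dependent_nat_choice)
    show "\<exists>p. p \<in> M \<and> ((0::nat) = 0 \<longrightarrow> p = p0)" using p0 by blast
    fix p and n :: nat assume "p \<in> M \<and> (n = 0 \<longrightarrow> p = p0)"
    then obtain q where "q \<in> A p" "\<forall>r\<in>A p. \<phi> q \<le> \<phi> r + (1/2) ^ n" using near_inf by blast
    moreover have "q \<in> M" using \<open>q \<in> A p\<close> by (simp add: A_def)
    ultimately show "\<exists>q. (q \<in> M \<and> (Suc n = 0 \<longrightarrow> q = p0)) \<and>
        (q \<in> A p \<and> (\<forall>r\<in>A p. \<phi> q \<le> \<phi> r + (1/2) ^ n))" by blast
  qed
  then obtain \<sigma> where \<sigma>M: "\<And>n. \<sigma> n \<in> M" and \<sigma>0: "\<sigma> 0 = p0"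
    and \<sigma>A: "\<And>n. \<sigma> (Suc n) \<in> A (\<sigma> n)"
    and \<sigma>_inf: "\<And>n r. r \<in> A (\<sigma> n) \<Longrightarrow> \<phi> (\<sigma> (Suc n)) \<le> \<phi> r + (1/2) ^ n"
    by metis
  have later: "\<sigma> m \<in> A (\<sigma> n)" if "n \<le> m" for n m
    using that by (induction m rule: dec_induct) (use A_refl A_trans \<sigma>A \<sigma>M in blast)+
  have drop: "\<phi> (\<sigma> m) + \<epsilon> * d (\<sigma> n) (\<sigma> m) \<le> \<phi> (\<sigma> n)" if "n \<le> m" for n m
    using later[OF that] by (simp add: A_def)
  have le: "\<phi> (\<sigma> m) \<le> \<phi> (\<sigma> n)" if "n \<le> m" for n m
  proof -
    have "0 \<le> \<epsilon> * d (\<sigma> n) (\<sigma> m)" using \<open>\<epsilon> > 0\<close> by simp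
    with drop[OF that] show ?thesis by linarith
  qed
  then have dec: "decseq (\<lambda>n. \<phi> (\<sigma> n))" by (simp add: decseq_def)
  obtain L where L: "(\<lambda>n. \<phi> (\<sigma> n)) \<longlonglongrightarrow> L" "\<And>n. L \<le> \<phi> (\<sigma> n)"
    using decseq_convergent[OF dec, of b] bdd \<sigma>M by metis
  have "MCauchy \<sigma>"
    unfolding MCauchy_def
  proof (intro conjI allI impI)
    fix e :: real assume "e > 0"
    then have "L < L + \<epsilon> * e / 2" using \<open>\<epsilon> > 0\<close> by simp
    then have "\<forall>\<^sub>F n in sequentially. \<phi> (\<sigma> n) < L + \<epsilon> * e / 2"
      by (rule order_tendstoD(2)[OF L(1)])
    then obtain K where K: "\<phi> (\<sigma> K) < L + \<epsilon> * e / 2"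
      unfolding eventually_sequentially by blast
    have close: "d (\<sigma> K) (\<sigma> n) < e / 2" if "K \<le> n" for n
    proof -
      have "\<epsilon> * d (\<sigma> K) (\<sigma> n) < \<epsilon> * (e / 2)"
        using drop[OF that] L(2)[of n] K by simp
      then show ?thesis using \<open>\<epsilon> > 0\<close> by simp
    qed
    have "d (\<sigma> n) (\<sigma> m) < e" if "K \<le> n" "K \<le> m" for n m
      using triangle''[OF \<sigma>M \<sigma>M \<sigma>M, of n m K] close[OF that(1)] close[OF that(2)] by simp
    then show "\<exists>K. \<forall>n n'. K \<le> n \<longrightarrow> K \<le> n' \<longrightarrow> d (\<sigma> n) (\<sigma> n') < e" by blast
  qed (use \<sigma>M in blast)
  then obtain p where lim: "limitin mtopology \<sigma> p sequentially"
    using complete unfolding mcomplete_def by blast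
  then have p: "p \<in> M" and conv: "\<And>e. e > 0 \<Longrightarrow> \<exists>K. \<forall>n\<ge>K. d (\<sigma> n) p < e"
    unfolding limit_metric_sequentially by blast+
  have pA: "p \<in> A (\<sigma> n)" for n
  proof -
    have "\<phi> p \<le> \<phi> (\<sigma> n) - \<epsilon> * d (\<sigma> n) p"
    proof (rule field_le_epsilon)
      fix e :: real assume "e > 0"
      let ?C = "{q \<in> M. \<phi> q \<le> \<phi> (\<sigma> n) - \<epsilon> * d (\<sigma> n) p + e}"
      obtain K where K: "\<And>m. m \<ge> K \<Longrightarrow> d (\<sigma> m) p < e / \<epsilon>"
        using conv[of "e / \<epsilon>"] \<open>e > 0\<close> \<open>\<epsilon> > 0\<close> by auto
      have "\<sigma> m \<in> ?C" if m: "m \<ge> max K n" for m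
      proof -
        have "d (\<sigma> n) p \<le> d (\<sigma> n) (\<sigma> m) + d (\<sigma> m) p" using \<sigma>M p by (intro triangle)
        then have "d (\<sigma> n) p \<le> d (\<sigma> n) (\<sigma> m) + e / \<epsilon>" using K[of m] m by simp
        then have "\<epsilon> * d (\<sigma> n) p \<le> \<epsilon> * (d (\<sigma> n) (\<sigma> m) + e / \<epsilon>)"
          using \<open>\<epsilon> > 0\<close> by simp
        also have "\<dots> = \<epsilon> * d (\<sigma> n) (\<sigma> m) + e" using \<open>\<epsilon> > 0\<close> by (simp add: field_simps)
        finally show ?thesis using drop[of n m] m \<sigma>M by simp
      qed
      then have "\<forall>\<^sub>F m in sequentially. \<sigma> m \<in> ?C"
        unfolding eventually_sequentially by blast
      then have "p \<in> ?C"
        by (rule limitin_closedin[OF lim lsc]) simp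
      then show "\<phi> p \<le> \<phi> (\<sigma> n) - \<epsilon> * d (\<sigma> n) p + e" by simp
    qed
    with p show ?thesis by (simp add: A_def)
  qed
  show thesis
  proof (rule that[OF p])
    have "0 \<le> \<epsilon> * d (\<sigma> n) p" for n using \<open>\<epsilon> > 0\<close> by simp
    then have p_le: "\<phi> p \<le> \<phi> (\<sigma> n)" for n
      using pA[of n] unfolding A_def mem_Collect_eq by (smt (verit))
    from p_le[of 0] show "\<phi> p \<le> \<phi> p0" by (simp add: \<sigma>0)
    have pL: "\<phi> p \<le> L" using L(1) p_le by (intro LIMSEQ_le_const) auto
    fix q assume q: "q \<in> M" "\<phi> q + \<epsilon> * d p q \<le> \<phi> p"
    then have "q \<in> A p" by (simp add: A_def)
    then have "q \<in> A (\<sigma> n)" for n using A_trans[OF pA _ \<sigma>M] by blast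
    then have "\<phi> (\<sigma> (Suc n)) \<le> \<phi> q + (1/2) ^ n" for n by (rule \<sigma>_inf)
    moreover have "(\<lambda>n. \<phi> q + (1/2) ^ n) \<longlonglongrightarrow> \<phi> q + 0"
      by (intro tendsto_intros LIMSEQ_power_zero) simp
    ultimately have "L \<le> \<phi> q"
      using LIMSEQ_le[OF LIMSEQ_Suc[OF L(1)], of "\<lambda>n. \<phi> q + (1/2) ^ n" "\<phi> q"] by simp
    then have "\<epsilon> * d p q \<le> 0" using q(2) pL by linarith
    then have "d p q = 0" using \<open>\<epsilon> > 0\<close> nonneg[of p q] by (simp add: mult_le_0_iff)
    then show "q = p" using p q(1) by simp
  qed
qed

text \<open>
  A point that is minimal in the sense of Ekeland's principle works: if \<open>\<phi>\<close> decreased faster than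
  at rate \<open>\<epsilon>\<close> in some direction, a short coordinate segment in this direction would lead to a
  point violating minimality, as its length is almost the length of its initial velocity.
\<close>

lemma almost_critical_point:
  fixes S :: "('i, 'a::{t2_space, second_countable_topology}, 'e::euclidean_space) rmfd"
    and \<phi> :: "'a \<Rightarrow> real"
  assumes R: "riemannian_manifold S" and conn: "connected (carrier S)"
    and complete: "complete_riemannian S" and "\<epsilon> > 0" and p0: "p0 \<in> carrier S"
    and bdd: "\<And>p. p \<in> carrier S \<Longrightarrow> b \<le> \<phi> p"
    and lsc: "\<And>a. closedin (top_of_set (carrier S)) {p \<in> carrier S. \<phi> p \<le> a}"
  obtains p where "p \<in> carrier S" "\<phi> p \<le> \<phi> p0"
    "\<And>i v D. p \<in> chart_dom S i \<Longrightarrow>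
       ((\<lambda>t. \<phi> (chart_inv S i (chart_map S i p + t *\<^sub>R v))) has_real_derivative D) (at 0) \<Longrightarrow>
       - \<epsilon> * tangent_norm S i p v \<le> D"
proof -
  note S = riemannian_smooth_manifold[OF R]
  interpret Metric_space "carrier S" "riem_dist S" by (rule riem_dist_metric[OF R conn])
  have lsc': "closedin mtopology {p \<in> carrier S. \<phi> p \<le> a}" for a
  proof -
    have "openin (top_of_set (carrier S)) (carrier S - {p \<in> carrier S. \<phi> p \<le> a})"
      using lsc[of a] by (simp add: closedin_def)
    then have "openin mtopology (carrier S - {p \<in> carrier S. \<phi> p \<le> a})"
      by (rule openin_metric_topology[OF R conn])
    then show ?thesis unfolding closedin_def topspace_mtopology by simp
  qed
  have "mcomplete" using complete by (simp add: complete_riemannian_def)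
  from ekeland_variational_principle[OF this \<open>\<epsilon> > 0\<close> p0 bdd lsc']
  obtain p where p: "p \<in> carrier S" "\<phi> p \<le> \<phi> p0"
    and min: "\<And>q. q \<in> carrier S \<Longrightarrow> \<phi> q + \<epsilon> * riem_dist S p q \<le> \<phi> p \<Longrightarrow> q = p"
    by blast
  show thesis
  proof (rule that[OF p])
    fix i v D
    let ?u = "chart_map S i p"
    let ?c = "\<lambda>t. chart_inv S i (?u + t *\<^sub>R v)"
    assume i: "p \<in> chart_dom S i"
      and D: "((\<lambda>t. \<phi> (?c t)) has_real_derivative D) (at 0)"
    show "- \<epsilon> * tangent_norm S i p v \<le> D"
    proof (rule ccontr)
      assume less: "\<not> ?thesis"
      have inv_u: "chart_inv S i ?u = p" by (rule chart_inv_map[OF S i])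
      have "v \<noteq> 0"
      proof
        assume "v = 0"
        then have "D = 0" using D by (auto intro: DERIV_unique)
        then show False using less \<open>\<epsilon> > 0\<close> tangent_norm_nonneg[OF R i, of v] by simp
      qed
      \<comment> \<open>\<open>B\<close> is the midpoint between \<open>tangent_norm S i p v\<close> and \<open>- D / \<epsilon>\<close>, so that a small
        increase of the norm along the segment does not spoil the estimate.\<close>
      define d where "d = D / \<epsilon>"
      define B where "B = (tangent_norm S i p v - d) / 2"
      have lt: "D < - (\<epsilon> * tangent_norm S i p v)" using less by simp
      then have d_less: "d < - tangent_norm S i p v"
        using \<open>\<epsilon> > 0\<close> by (simp add: d_def pos_divide_less_eq mult.commute)
      have \<epsilon>B: "\<epsilon> * B = (\<epsilon> * tangent_norm S i p v - D) / 2"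
        unfolding B_def d_def using \<open>\<epsilon> > 0\<close> by (simp add: right_diff_distrib)
      have B: "tangent_norm S i p v < B" using d_less unfolding B_def by simp
      have \<epsilon>B_less: "D < - (\<epsilon> * B)" unfolding \<epsilon>B using lt by (simp add: field_simps)
      let ?O = "{t. ?u + t *\<^sub>R v \<in> chart_img S i}"
      have "open (chart_img S i)" by (rule open_chart_img[OF S])
      then have "open ((\<lambda>t. ?u + t *\<^sub>R v) -` chart_img S i)"
        by (intro open_vimage continuous_intros)
      then have O: "open ?O" by (simp add: vimage_def)
      have O0: "0 \<in> ?O" using chart_map_in_img[OF S i] by simp
      have "continuous_on ?O (\<lambda>t. (?u + t *\<^sub>R v, v))" by (intro continuous_intros)
      moreover have "(\<lambda>t. (?u + t *\<^sub>R v, v)) ` ?O \<subseteq> chart_img S i \<times> UNIV" by auto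
      ultimately have "continuous_on ?O (\<lambda>t. tangent_norm S i (?c t) v)"
        using continuous_on_compose2[OF continuous_on_tangent_norm[OF R, of i], of ?O "\<lambda>t. (?u + t *\<^sub>R v, v)"]
        by simp
      then have "isCont (\<lambda>t. tangent_norm S i (?c t) v) 0"
        using O O0 by (simp add: continuous_on_eq_continuous_at)
      then have "((\<lambda>t. tangent_norm S i (?c t) v) \<longlongrightarrow> tangent_norm S i p v) (at 0)"
        unfolding isCont_def using inv_u by simp
      then have "\<forall>\<^sub>F t in at 0. tangent_norm S i (?c t) v < B"
        using B by (rule order_tendstoD)
      moreover have "\<forall>\<^sub>F t in at 0. t \<in> ?O"
        using O O0 by (rule eventually_at_in_open')
      ultimately have "\<forall>\<^sub>F t in at 0. tangent_norm S i (?c t) v < B \<and> t \<in> ?O"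
        by (rule eventually_conj)
      then obtain r where r: "r > 0"
        "\<And>t. t \<noteq> 0 \<Longrightarrow> dist t 0 < r \<Longrightarrow> tangent_norm S i (?c t) v < B \<and> t \<in> ?O"
        unfolding eventually_at by blast
      have near: "tangent_norm S i (?c t) v < B" "t \<in> ?O" if "\<bar>t\<bar> < r" for t
        using r(2)[of t] that B O0 inv_u by (cases "t = 0"; simp)+
      have "((\<lambda>t. (\<phi> (?c t) - \<phi> p) / t) \<longlongrightarrow> D) (at 0)"
        using D inv_u by (simp add: has_field_derivative_iff)
      then have "\<forall>\<^sub>F t in at 0. (\<phi> (?c t) - \<phi> p) / t < - (\<epsilon> * B)"
        using \<epsilon>B_less by (rule order_tendstoD)
      then obtain r' where r': "r' > 0"
        "\<And>t. t \<noteq> 0 \<Longrightarrow> dist t 0 < r' \<Longrightarrow> (\<phi> (?c t) - \<phi> p) / t < - (\<epsilon> * B)"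
        unfolding eventually_at by blast
      define t where "t = min r r' / 2"
      have t: "t > 0" "t < r" "t < r'" using r(1) r'(1) by (auto simp: t_def)
      have t_seg: "\<exists>s. y = ?u + s *\<^sub>R v \<and> \<bar>s\<bar> < r" if "y \<in> closed_segment ?u (?u + t *\<^sub>R v)" for y
      proof -
        obtain k where k: "0 \<le> k" "k \<le> 1" "y = (1 - k) *\<^sub>R ?u + k *\<^sub>R (?u + t *\<^sub>R v)"
          using \<open>y \<in> _\<close> unfolding in_segment(1) by blast
        have "y = ?u + (k * t) *\<^sub>R v" using k(3) by (simp add: algebra_simps)
        moreover have "k * t \<le> t" "0 \<le> k * t" using k t by simp_all
        then have "\<bar>k * t\<bar> < r" using t(2) by linarith
        ultimately show ?thesis by (intro exI[of _ "k * t"]) simp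
      qed
      have "riem_dist S (chart_inv S i ?u) (chart_inv S i (?u + t *\<^sub>R v)) \<le> t * B"
      proof (rule riem_dist_chart_segment_le[OF R])
        show "closed_segment ?u (?u + t *\<^sub>R v) \<subseteq> chart_img S i"
          using t_seg near(2) by auto
        fix y assume "y \<in> closed_segment ?u (?u + t *\<^sub>R v)"
        then obtain s where s: "y = ?u + s *\<^sub>R v" "\<bar>s\<bar> < r" using t_seg by blast
        have "?c s \<in> chart_dom S i" using near(2)[OF s(2)] by (auto intro: chart_inv_in_dom[OF S])
        then show "tangent_norm S i (chart_inv S i y) (t *\<^sub>R v) \<le> t * B"
          using tangent_norm_scale[OF R, of "?c s" i t v] near(1)[OF s(2)] s(1) t(1) by simp
      qed
      then have dist: "riem_dist S p (?c t) \<le> t * B" by (simp add: inv_u)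
      have "(\<phi> (?c t) - \<phi> p) / t < - (\<epsilon> * B)" using r'(2)[of t] t by simp
      then have "\<phi> (?c t) + \<epsilon> * (t * B) \<le> \<phi> p" using t(1) by (simp add: field_simps)
      moreover have "\<epsilon> * riem_dist S p (?c t) \<le> \<epsilon> * (t * B)"
        using dist \<open>\<epsilon> > 0\<close> by simp
      ultimately have "\<phi> (?c t) + \<epsilon> * riem_dist S p (?c t) \<le> \<phi> p" by linarith
      moreover have img: "?u + t *\<^sub>R v \<in> chart_img S i" using near(2)[of t] t by simp
      then have "?c t \<in> carrier S"
        using chart_inv_in_dom[OF S img] unfolding carrier_def by blast
      ultimately have "?c t = p" using min by blast
      then have "chart_map S i (?c t) = ?u" by simp
      then have "?u + t *\<^sub>R v = ?u" using chart_map_inv[OF S img] by simp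
      then show False using t(1) \<open>v \<noteq> 0\<close> by simp
    qed
  qed
qed

section \<open>Local homotheties of complete manifolds\<close>

text \<open>
  Every point of \<open>M\<close> has a neighbourhood \<open>V\<close> that lies in the image as soon as it meets the image;
  by connectedness, the image is then everything. To reach \<open>q \<in> V\<close>, the coordinate distance from
  \<open>y p\<close> to \<open>q\<close>, truncated at the radius of a ball that contains \<open>V\<close>, is made almost critical,
  starting from a preimage of a point of \<open>V\<close>. At the point found this way \<open>y\<close> is still in the
  ball. If it did not hit \<open>q\<close>, then moving \<open>y\<close> straight towards \<open>q\<close>, possible because \<open>D\<close>
  is onto, would decrease the distance too fast.
\<close>

lemma complete_local_homothety_surj:
  fixes S :: "('i, 'a::{t2_space, second_countable_topology}, 'e::euclidean_space) rmfd"
    and M :: "('j, 'b::{t2_space, second_countable_topology}, 'f::euclidean_space) rmfd"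
  assumes S: "riemannian_manifold S" "connected (carrier S)" "complete_riemannian S" "carrier S \<noteq> {}"
    and M: "riemannian_manifold M" "connected (carrier M)"
    and y: "continuous_on (carrier S) y" "y ` carrier S \<subseteq> carrier M"
    and "\<kappa> > 0"
    and deriv: "\<And>i j p. p \<in> chart_dom S i \<Longrightarrow> y p \<in> chart_dom M j \<Longrightarrow> \<exists>D.
      ((chart_map M j \<circ> y \<circ> chart_inv S i) has_derivative D) (at (chart_map S i p)) \<and> surj D \<and>
      (\<forall>v. tangent_norm S i p v = \<kappa> * tangent_norm M j (y p) (D v))"
  shows "y ` carrier S = carrier M"
proof -
  note sS = riemannian_smooth_manifold[OF S(1)] and sM = riemannian_smooth_manifold[OF M(1)]
  have local: "\<exists>V. openin (top_of_set (carrier M)) V \<and> m \<in> V \<and>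
      (\<forall>q0\<in>V. \<forall>q\<in>V. q0 \<in> y ` carrier S \<longrightarrow> q \<in> y ` carrier S)" if "m \<in> carrier M" for m
  proof -
    from that obtain j where j: "m \<in> chart_dom M j" by (auto simp: carrier_def)
    obtain r where r: "r > 0" "cball (chart_map M j m) r \<subseteq> chart_img M j"
      using chart_ball_exists[OF sM j] by blast
    let ?m = "chart_map M j m"
    let ?V = "chart_inv M j ` ball ?m (r / 4)"
    have "ball ?m (r / 4) \<subseteq> cball ?m r" using r(1) by auto
    then have img4: "ball ?m (r / 4) \<subseteq> chart_img M j" using r(2) by (rule subset_trans)
    have "openin (top_of_set (carrier M)) ?V"
      by (intro openin_chart_inv_image[OF sM] open_ball img4)
    moreover have "m \<in> ?V"
      using r(1) chart_inv_map[OF sM j] by (intro image_eqI[of _ _ ?m]) auto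
    moreover have "q \<in> y ` carrier S"
      if "q0 \<in> ?V" "q \<in> ?V" "q0 \<in> y ` carrier S" for q0 q
    proof -
      from that(3) obtain p0 where p0: "q0 = y p0" "p0 \<in> carrier S" by (rule imageE)
      from that(1) obtain w0 where w0: "q0 = chart_inv M j w0" "w0 \<in> ball ?m (r / 4)" by (rule imageE)
      from that(2) obtain w where w: "q = chart_inv M j w" "w \<in> ball ?m (r / 4)" by (rule imageE)
      \<comment> \<open>Points of \<open>V\<close> have coordinate distance below \<open>r / 2\<close> from each other, and the ball of
        this radius around a point of \<open>V\<close> stays in the ball of radius \<open>r\<close>.\<close>
      define \<rho> where "\<rho> = r / 2"
      have "\<rho> > 0" using r(1) by (simp add: \<rho>_def)
      have "cball w \<rho> \<subseteq> cball ?m r"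
      proof
        fix z assume "z \<in> cball w \<rho>"
        then show "z \<in> cball ?m r"
          using dist_triangle[of ?m z w] w(2) r(1) by (simp add: \<rho>_def)
      qed
      then have img: "cball w \<rho> \<subseteq> chart_img M j" using r(2) by (rule subset_trans)
      have "dist w w0 < \<rho>"
        using dist_triangle[of w w0 ?m] w(2) w0(2) by (simp add: \<rho>_def dist_commute)
      obtain C where "C > 0"
        and C: "\<And>z v. z \<in> cball w \<rho> \<Longrightarrow> tangent_norm M j (chart_inv M j z) v \<le> C * norm v"
        using tangent_norm_bounds[OF M(1) compact_cball img] by metis
      \<comment> \<open>The truncation makes \<open>\<phi>\<close> lower semicontinuous: its sublevel sets below \<open>\<rho>\<close> are preimages
        of compact sets.\<close>
      define \<phi> where "\<phi> p = (if y p \<in> chart_inv M j ` ball w \<rho>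
        then norm (chart_map M j (y p) - w) else \<rho>)" for p
      have in_img: "z \<in> chart_img M j" if "z \<in> ball w \<rho>" for z
        using that img by auto
      have \<phi>_inv: "\<phi> p = norm (z - w)" if "y p = chart_inv M j z" "z \<in> ball w \<rho>" for p z
        unfolding \<phi>_def using that chart_map_inv[OF sM in_img[OF that(2)]] by simp
      have \<phi>_less: "\<exists>z. y p = chart_inv M j z \<and> z \<in> ball w \<rho>" if "\<phi> p < \<rho>" for p
      proof -
        have "y p \<in> chart_inv M j ` ball w \<rho>"
          using that unfolding \<phi>_def by (simp split: if_splits)
        then obtain z where "y p = chart_inv M j z" "z \<in> ball w \<rho>" by (rule imageE)
        then show ?thesis by (intro exI[of _ z] conjI)
      qed
      have \<phi>_le: "\<phi> p \<le> \<rho>" for p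
      proof (cases "y p \<in> chart_inv M j ` ball w \<rho>")
        case True
        then obtain z where "y p = chart_inv M j z" "z \<in> ball w \<rho>" by (rule imageE)
        with \<phi>_inv show ?thesis by (simp add: dist_norm norm_minus_commute)
      qed (simp add: \<phi>_def)
      have \<phi>p0: "\<phi> p0 < \<rho>"
        using \<phi>_inv[of p0 w0] p0(1) w0(1) \<open>dist w w0 < \<rho>\<close> by (simp add: dist_norm norm_minus_commute)
      have bdd: "0 \<le> \<phi> p" for p using \<open>\<rho> > 0\<close> by (simp add: \<phi>_def)
      have lsc: "closedin (top_of_set (carrier S)) {p \<in> carrier S. \<phi> p \<le> a}" for a
      proof (cases "\<rho> \<le> a")
        case True
        then have "{p \<in> carrier S. \<phi> p \<le> a} = carrier S" using \<phi>_le by (auto intro: order_trans)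
        then show ?thesis by simp
      next
        case False
        let ?K = "chart_inv M j ` cball w a"
        have a_img: "z \<in> ball w \<rho>" if "z \<in> cball w a" for z using that False by simp
        have "\<phi> p \<le> a \<longleftrightarrow> y p \<in> ?K" for p
        proof
          assume le: "\<phi> p \<le> a"
          then obtain z where z: "y p = chart_inv M j z" "z \<in> ball w \<rho>"
            using \<phi>_less[of p] False by auto
          then have "z \<in> cball w a"
            using \<phi>_inv[OF z] le by (simp add: dist_norm norm_minus_commute)
          then show "y p \<in> ?K" using z(1) by simp
        next
          assume "y p \<in> ?K"
          then obtain z where z: "y p = chart_inv M j z" "z \<in> cball w a" by (rule imageE)
          then show "\<phi> p \<le> a"
            using \<phi>_inv[OF z(1) a_img[OF z(2)]] by (simp add: dist_norm norm_minus_commute)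
        qed
        then have eq: "{p \<in> carrier S. \<phi> p \<le> a} = carrier S \<inter> y -` ?K" by auto
        have "cball w a \<subseteq> chart_img M j" using a_img in_img by blast
        then have "closed ?K"
          by (intro compact_imp_closed compact_chart_inv_image[OF sM] compact_cball)
        then show ?thesis unfolding eq using y(1) by (intro continuous_closedin_preimage)
      qed
      \<comment> \<open>Moving \<open>y p\<close> towards \<open>q\<close> at unit coordinate speed costs a length of at most \<open>\<kappa> * C\<close>;
        half of the resulting rate is still contradictory.\<close>
      define \<epsilon> where "\<epsilon> = 1 / (2 * \<kappa> * C)"
      have "\<epsilon> > 0" using \<open>C > 0\<close> \<open>\<kappa> > 0\<close> by (simp add: \<epsilon>_def)
      obtain p where p: "p \<in> carrier S" "\<phi> p \<le> \<phi> p0"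
        and crit: "\<And>i v D. p \<in> chart_dom S i \<Longrightarrow>
          ((\<lambda>t. \<phi> (chart_inv S i (chart_map S i p + t *\<^sub>R v))) has_real_derivative D) (at 0) \<Longrightarrow>
          - \<epsilon> * tangent_norm S i p v \<le> D"
        using almost_critical_point[OF S(1,2,3) \<open>\<epsilon> > 0\<close> p0(2) bdd lsc] by blast
      obtain z where z: "y p = chart_inv M j z" "z \<in> ball w \<rho>"
        using \<phi>_less[of p] p(2) \<phi>p0 by auto
      have zj: "chart_map M j (y p) = z" using z chart_map_inv[OF sM in_img] by simp
      have "z = w"
      proof (rule ccontr)
        assume "z \<noteq> w"
        obtain i where i: "p \<in> chart_dom S i" using p(1) by (auto simp: carrier_def)
        let ?u = "chart_map S i p"
        have yj: "y p \<in> chart_dom M j"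
          using z chart_inv_in_dom[OF sM in_img] by simp
        obtain D where D: "((chart_map M j \<circ> y \<circ> chart_inv S i) has_derivative D) (at ?u)" "surj D"
          "\<And>v. tangent_norm S i p v = \<kappa> * tangent_norm M j (y p) (D v)"
          using deriv[OF i yj] by blast
        obtain v where v: "D v = w - z" using surjD[OF D(2), of "w - z"] by auto
        let ?g = "\<lambda>t. chart_map M j (y (chart_inv S i (?u + t *\<^sub>R v))) - w"
        have inv_u: "chart_inv S i ?u = p" by (rule chart_inv_map[OF sS i])
        then have g0: "?g 0 = z - w" using zj by simp
        have "((\<lambda>t::real. ?u + t *\<^sub>R v) has_derivative (\<lambda>h. h *\<^sub>R v)) (at 0)"
          by (auto intro!: derivative_eq_intros)
        moreover have "((chart_map M j \<circ> y \<circ> chart_inv S i) has_derivative D) (at (?u + 0 *\<^sub>R v))"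
          using D(1) by simp
        ultimately have "((\<lambda>t. (chart_map M j \<circ> y \<circ> chart_inv S i) (?u + t *\<^sub>R v)) has_derivative
            (\<lambda>h. D (h *\<^sub>R v))) (at 0)"
          by (rule has_derivative_compose)
        moreover have "D (h *\<^sub>R v) = h *\<^sub>R (w - z)" for h
          using linear_scale[OF has_derivative_linear[OF D(1)], of h v] v by simp
        ultimately have g': "(?g has_derivative (\<lambda>h. h *\<^sub>R (w - z))) (at 0)"
          by (auto intro!: derivative_eq_intros simp: o_def)
        have "(norm has_derivative (\<lambda>k. k \<bullet> sgn (?g 0))) (at (?g 0))"
          using \<open>z \<noteq> w\<close> g0 by (intro has_derivative_norm) simp
        then have dn: "((\<lambda>t. norm (?g t)) has_derivative (\<lambda>h. (h *\<^sub>R (w - z)) \<bullet> sgn (?g 0))) (at 0)"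
          using has_derivative_compose[OF g'] by blast
        have ip: "(h *\<^sub>R (w - z)) \<bullet> sgn (?g 0) = - norm (z - w) * h" for h
        proof -
          have "(w - z) \<bullet> sgn (z - w) = - ((z - w) \<bullet> (z - w)) / norm (z - w)"
            by (simp add: sgn_div_norm inner_diff_left divide_inverse algebra_simps)
          also have "\<dots> = - norm (z - w)"
            using \<open>z \<noteq> w\<close> by (simp add: dot_square_norm power2_eq_square)
          finally show ?thesis using g0 by (simp add: mult.commute)
        qed
        have norm': "((\<lambda>t. norm (?g t)) has_real_derivative - norm (z - w)) (at 0)"
        proof (rule has_derivative_imp_has_field_derivative[OF dn])
          show "h * - norm (z - w) = (h *\<^sub>R (w - z)) \<bullet> sgn (?g 0)" for h
            unfolding ip by simp
        qed
        let ?V' = "chart_inv M j ` ball w \<rho>"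
        have "openin (top_of_set (carrier M)) ?V'"
          using in_img by (intro openin_chart_inv_image[OF sM] open_ball) blast
        then have "openin (top_of_set (carrier S)) (carrier S \<inter> y -` ?V')"
          using y by (intro continuous_openin_preimage[of _ _ "carrier M"]) auto
        then have "openin (top_of_set (carrier S)) (chart_dom S i \<inter> (carrier S \<inter> y -` ?V'))"
          by (rule openin_Int[OF openin_chart_dom[OF sS]])
        then have openO: "open (chart_map S i ` (chart_dom S i \<inter> (carrier S \<inter> y -` ?V')))" (is "open ?O")
          by (rule open_chart_map_image[OF sS]) blast
        have "?u \<in> ?O" using i p(1) z by (intro imageI) auto
        have "((\<lambda>t. \<phi> (chart_inv S i (?u + t *\<^sub>R v))) has_real_derivative - norm (z - w)) (at 0)"
        proof (rule has_field_derivative_transform_within_open[OF norm'])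
          show "open ((\<lambda>t. ?u + t *\<^sub>R v) -` ?O)"
            by (intro open_vimage openO continuous_intros)
          show "0 \<in> (\<lambda>t. ?u + t *\<^sub>R v) -` ?O" using \<open>?u \<in> ?O\<close> by simp
          fix t assume "t \<in> (\<lambda>t. ?u + t *\<^sub>R v) -` ?O"
          then have "?u + t *\<^sub>R v \<in> ?O" by simp
          then obtain p' where p'O: "?u + t *\<^sub>R v = chart_map S i p'"
            "p' \<in> chart_dom S i \<inter> (carrier S \<inter> y -` ?V')" by (rule imageE)
          then have p': "?u + t *\<^sub>R v = chart_map S i p'" "p' \<in> chart_dom S i" "y p' \<in> ?V'"
            by simp_all
          have "chart_inv S i (?u + t *\<^sub>R v) = p'"
            unfolding p'(1) by (rule chart_inv_map[OF sS p'(2)])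
          then show "norm (?g t) = \<phi> (chart_inv S i (?u + t *\<^sub>R v))"
            using p'(3) by (simp add: \<phi>_def)
        qed
        then have "- \<epsilon> * tangent_norm S i p v \<le> - norm (z - w)" by (rule crit[OF i])
        moreover have "tangent_norm M j (y p) (w - z) \<le> C * norm (w - z)"
          using C[of z "w - z"] z by simp
        then have "\<epsilon> * tangent_norm S i p v \<le> \<epsilon> * (\<kappa> * (C * norm (w - z)))"
          using D(3)[of v] v \<open>\<epsilon> > 0\<close> \<open>\<kappa> > 0\<close> by simp
        moreover have "\<epsilon> * (\<kappa> * (C * norm (w - z))) = norm (z - w) / 2"
          using \<open>C > 0\<close> \<open>\<kappa> > 0\<close> by (simp add: \<epsilon>_def norm_minus_commute)
        ultimately have "norm (z - w) \<le> norm (z - w) / 2" by linarith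
        then show False using \<open>z \<noteq> w\<close> by simp
      qed
      then have "q = y p" using z(1) w(1) by simp
      then show ?thesis using p(1) by (rule image_eqI)
    qed
    ultimately show ?thesis by (intro exI[of _ ?V] conjI ballI impI)
  qed
  obtain p1 where p1: "p1 \<in> carrier S" using S(4) by blast
  then have q1: "y p1 \<in> carrier M" using y(2) by blast
  have "q \<in> y ` carrier S" if q: "q \<in> carrier M" for q
  proof -
    have "y p1 \<in> y ` carrier S \<longleftrightarrow> q \<in> y ` carrier S"
    proof (rule connected_equivalence_relation[OF M(2) q1 q])
      fix m assume "m \<in> carrier M"
      from local[OF this] show "\<exists>T. openin (top_of_set (carrier M)) T \<and> m \<in> T \<and>
          (\<forall>q\<in>T. m \<in> y ` carrier S \<longleftrightarrow> q \<in> y ` carrier S)" by metis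
    qed auto
    then show ?thesis using p1 by simp
  qed
  then show ?thesis by (intro equalityI[OF y(2)] subsetI)
qed

section \<open>Hypersurfaces of warped products\<close>

lemma warped_product_simps:
  "chart_dom (warped_product I f M) j = I \<times> chart_dom M j"
  "chart_map (warped_product I f M) j z = (fst z, chart_map M j (snd z))"
  "chart_metric (warped_product I f M) j z v w =
     fst v * fst w + (f (fst z))\<^sup>2 * chart_metric M j (snd z) (snd v) (snd w)"
  "carrier (warped_product I f M) = I \<times> carrier M"
  by (auto simp: warped_product_def carrier_def split_beta)

text \<open>
  Pointwise linear algebra: \<open>G\<close> is the metric of the ambient space and \<open>D\<close> the differential of
  the immersion. The tangential part \<open>e = \<partial>\<^sub>t - \<Theta> N\<close> of the vertical field is orthogonal to \<open>N\<close>,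
  and \<open>G e e = 1 - \<Theta>\<^sup>2\<close>. It lies in the range of \<open>D\<close>, since this range has codimension one and is
  contained in the orthogonal complement of \<open>N\<close>. The last claim says that the gradient of the
  height has the squared length \<open>1 - \<Theta>\<^sup>2\<close>.
\<close>

lemma vertical_field_of_hypersurface:
  fixes G :: "real \<times> 'e::euclidean_space \<Rightarrow> real \<times> 'e \<Rightarrow> real" and D :: "'e \<Rightarrow> real \<times> 'e"
  assumes bil: "bilinear G" and sym: "\<And>v w. G v w = G w v" and pos: "\<And>w. w \<noteq> 0 \<Longrightarrow> G w w > 0"
    and D: "linear D" "inj D"
    and N: "G N N = 1" "\<And>v. G N (D v) = 0"
    and dt: "\<And>w. G (1, 0) w = fst w" and \<Theta>: "G N (1, 0) = \<Theta>"
  shows "\<Theta>\<^sup>2 \<le> 1" and "\<Theta>\<^sup>2 = 1 \<Longrightarrow> fst (D v) = 0"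
    and "\<exists>v. fst (D v) = 1 - \<Theta>\<^sup>2 \<and> G (D v) (D v) = 1 - \<Theta>\<^sup>2"
proof -
  define e where "e = (1, 0) - \<Theta> *\<^sub>R N"
  have Ge: "G e w = fst w - \<Theta> * G N w" for w
    using dt by (simp add: e_def bilinear_lsub[OF bil] bilinear_lmul[OF bil])
  have fst_N: "fst N = \<Theta>" using dt[of N] \<Theta> sym by simp
  have Gee: "G e e = 1 - \<Theta>\<^sup>2"
  proof -
    have "G e e = G e (1, 0) - G e (\<Theta> *\<^sub>R N)"
      using bilinear_rsub[OF bil, of e "(1, 0)" "\<Theta> *\<^sub>R N"] by (simp flip: e_def)
    then show ?thesis
      using Ge[of "(1, 0)"] Ge[of N] N(1) \<Theta> fst_N
      by (simp add: bilinear_rmul[OF bil] power2_eq_square)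
  qed
  have nonneg: "G w w \<ge> 0" for w
    using pos[of w] bilinear_lzero[OF bil] by (cases "w = 0") (auto intro: less_imp_le)
  show "\<Theta>\<^sup>2 \<le> 1" using nonneg[of e] Gee by simp
  show "fst (D v) = 0" if "\<Theta>\<^sup>2 = 1"
  proof -
    have "G e e = 0" using Gee that by simp
    then have "e = 0" using pos[of e] by fastforce
    then show ?thesis using Ge[of "D v"] N(2)[of v] bilinear_lzero[OF bil] by simp
  qed
  have Ne: "G N e = 0"
    using N(1) \<Theta> by (simp add: e_def bilinear_rsub[OF bil] bilinear_rmul[OF bil])
  let ?P = "{w. G N w = 0}"
  have P: "subspace ?P"
    unfolding subspace_def
    by (simp add: bilinear_rzero[OF bil] bilinear_radd[OF bil] bilinear_rmul[OF bil])
  have sub: "range D \<subseteq> ?P" using N(2) by auto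
  have "N \<notin> ?P" using N(1) by simp
  then have "span ?P \<subset> span (UNIV :: (real \<times> 'e) set)"
    using P by (auto simp: span_eq_iff[THEN iffD2])
  then have "dim ?P < dim (UNIV :: (real \<times> 'e) set)" by (rule dim_psubset)
  then have "dim ?P \<le> DIM('e)" by (simp add: dim_UNIV)
  moreover have "dim (range D) = DIM('e)"
    using dim_image_eq[OF D(1), of UNIV] D(2) by (simp add: dim_UNIV)
  moreover have "subspace (range D)" using D(1) by (intro linear_subspace_image) auto
  ultimately have "range D = ?P" using P sub by (intro subspace_dim_equal) auto
  then obtain v where v: "D v = e" using Ne by (metis (mono_tags, lifting) mem_Collect_eq rangeE)
  have "fst e = 1 - \<Theta>\<^sup>2" using fst_N by (simp add: e_def power2_eq_square)
  then show "\<exists>v. fst (D v) = 1 - \<Theta>\<^sup>2 \<and> G (D v) (D v) = 1 - \<Theta>\<^sup>2"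
    using v Gee by (intro exI[of _ v]) simp
qed

lemma warped_product_metric:
  assumes M: "riemannian_manifold M" and "f (fst z) > 0" and z: "snd z \<in> chart_dom M j"
  shows "bilinear (chart_metric (warped_product I f M) j z)"
    and "chart_metric (warped_product I f M) j z v w = chart_metric (warped_product I f M) j z w v"
    and "w \<noteq> 0 \<Longrightarrow> chart_metric (warped_product I f M) j z w w > 0"
proof -
  have b: "bilinear (chart_metric M j (snd z))" by (rule chart_metric_bilinear[OF M z])
  show "bilinear (chart_metric (warped_product I f M) j z)"
    unfolding bilinear_def
    by (auto intro!: linearI simp: warped_product_simps bilinear_ladd[OF b] bilinear_radd[OF b]
        bilinear_lmul[OF b] bilinear_rmul[OF b] algebra_simps)
  have "chart_metric M j (snd z) (snd v) (snd w) = chart_metric M j (snd z) (snd w) (snd v)"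
    using M z unfolding riemannian_manifold_def by blast
  then show "chart_metric (warped_product I f M) j z v w = chart_metric (warped_product I f M) j z w v"
    by (simp add: warped_product_simps mult.commute)
  show "chart_metric (warped_product I f M) j z w w > 0" if "w \<noteq> 0"
  proof (cases "snd w = 0")
    case True
    then have "fst w \<noteq> 0" using that by (simp add: prod_eq_iff)
    then show ?thesis
      using True bilinear_lzero[OF b] by (simp add: warped_product_simps flip: power2_eq_square)
  next
    case False
    then have "chart_metric M j (snd z) (snd w) (snd w) > 0" by (rule chart_metric_pos[OF M z])
    then show ?thesis
      using assms(2) by (simp add: warped_product_simps add_nonneg_pos)
  qed
qed

text \<open>
  The two components of the differential are the derivatives of the height and of the projection
  to \<open>M\<close>. An interval \<open>I\<close> with end points is harmless here, since the domain of the map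
  in coordinates is open in any case.
\<close>

lemma smooth_map_differential:
  fixes S :: "('k, 's::{t2_space, second_countable_topology}, 'e::euclidean_space) rmfd"
    and M :: "('i, 'm::{t2_space, second_countable_topology}, 'f::euclidean_space) rmfd"
  assumes S: "smooth_manifold S" and M: "smooth_manifold M"
    and x: "smooth_map S (warped_product I f M) x"
    and p: "p \<in> chart_dom S i" "x p \<in> chart_dom (warped_product I f M) j"
  defines "D \<equiv> differential S (warped_product I f M) x i j p"
  shows "((\<lambda>u. fst (x (chart_inv S i u))) has_derivative (\<lambda>v. fst (D v))) (at (chart_map S i p))"
    and "((chart_map M j \<circ> (\<lambda>q. snd (x q)) \<circ> chart_inv S i) has_derivative (\<lambda>v. snd (D v)))
      (at (chart_map S i p))"
    and "linear D"
proof -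
  let ?W = "warped_product I f M" and ?u = "chart_map S i p"
  let ?F = "chart_map ?W j \<circ> x \<circ> chart_inv S i"
  let ?O = "chart_map S i ` (chart_dom S i \<inter> x -` chart_dom ?W j)"
  have x': "x ` carrier S \<subseteq> carrier ?W" "continuous_on (carrier S) x"
    using x by (auto simp: smooth_map_def)
  \<comment> \<open>The domain of \<open>?F\<close> is open, so derivatives within it are derivatives.\<close>
  have "openin (top_of_set (carrier ?W)) (chart_dom ?W j)"
    unfolding warped_product_simps by (intro openin_Times openin_chart_dom[OF M]) simp
  then have "openin (top_of_set (carrier S)) (carrier S \<inter> x -` chart_dom ?W j)"
    using x' by (intro continuous_openin_preimage[of _ _ "carrier ?W"]) auto
  then have "openin (top_of_set (carrier S)) (chart_dom S i \<inter> (carrier S \<inter> x -` chart_dom ?W j))"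
    by (rule openin_Int[OF openin_chart_dom[OF S]])
  moreover have "chart_dom S i \<inter> (carrier S \<inter> x -` chart_dom ?W j) = chart_dom S i \<inter> x -` chart_dom ?W j"
    using chart_dom_subset[OF S, of i] by blast
  ultimately have O: "open ?O" using open_chart_map_image[OF S] by simp
  have u: "?u \<in> ?O" using p by (intro imageI) simp
  have "Ck_on (Suc 0) ?O ?F"
    using x unfolding smooth_map_def smooth_on_def by blast
  then have "?F differentiable_on ?O" by simp
  then have "?F differentiable (at ?u within ?O)" using u unfolding differentiable_on_def by (rule bspec)
  then have "?F differentiable (at ?u)" unfolding at_within_open[OF u O] .
  then have F: "(?F has_derivative D) (at ?u)"
    unfolding D_def differential_def frechet_derivative_works .
  then show "linear D" by (rule has_derivative_linear)
  show "((\<lambda>u. fst (x (chart_inv S i u))) has_derivative (\<lambda>v. fst (D v))) (at ?u)"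
    using has_derivative_fst[OF F] by (simp add: o_def warped_product_simps)
  show "((chart_map M j \<circ> (\<lambda>q. snd (x q)) \<circ> chart_inv S i) has_derivative (\<lambda>v. snd (D v))) (at ?u)"
    using has_derivative_snd[OF F] by (simp add: o_def warped_product_simps)
qed

lemma constant_on_if_zero_chart_derivative:
  fixes S :: "('i, 'a::{t2_space, second_countable_topology}, 'e::euclidean_space) rmfd"
    and h :: "'a \<Rightarrow> real"
  assumes S: "smooth_manifold S" and conn: "connected (carrier S)"
    and deriv: "\<And>i p. p \<in> chart_dom S i \<Longrightarrow>
      ((\<lambda>u. h (chart_inv S i u)) has_derivative (\<lambda>v. 0)) (at (chart_map S i p))"
    and "p \<in> carrier S" "q \<in> carrier S"
  shows "h p = h q"
  using conn assms(4,5)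
proof (rule connected_equivalence_relation)
  fix a assume "a \<in> carrier S"
  then obtain i where i: "a \<in> chart_dom S i" by (auto simp: carrier_def)
  let ?u = "chart_map S i a"
  obtain r where r: "r > 0" "cball ?u r \<subseteq> chart_img S i"
    using chart_ball_exists[OF S i] by blast
  have img: "ball ?u r \<subseteq> chart_img S i"
    using r(2) ball_subset_cball by (rule subset_trans[rotated])
  let ?V = "chart_inv S i ` ball ?u r"
  have "openin (top_of_set (carrier S)) ?V"
    by (intro openin_chart_inv_image[OF S] open_ball img)
  moreover have "a \<in> ?V"
    using r(1) chart_inv_map[OF S i] by (intro image_eqI[of _ _ ?u]) auto
  moreover have "h a = h b" if "b \<in> ?V" for b
  proof -
    from that obtain y where y: "b = chart_inv S i y" "y \<in> ball ?u r" by (rule imageE)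
    have "((\<lambda>u. h (chart_inv S i u)) has_derivative (\<lambda>v. 0)) (at z within ball ?u r)"
      if "z \<in> ball ?u r" for z
    proof -
      have z: "z \<in> chart_img S i" using that by (rule subsetD[OF img])
      show ?thesis
        using deriv[OF chart_inv_in_dom[OF S z]] unfolding chart_map_inv[OF S z]
        by (rule has_derivative_at_withinI)
    qed
    then obtain c where "\<And>z. z \<in> ball ?u r \<Longrightarrow> h (chart_inv S i z) = c"
      using has_derivative_zero_constant[OF convex_ball, of ?u r "\<lambda>u. h (chart_inv S i u)"] by auto
    from this[of ?u] this[OF y(2)] show ?thesis
      using r(1) chart_inv_map[OF S i] y(1) by simp
  qed
  ultimately show "\<exists>T. openin (top_of_set (carrier S)) T \<and> a \<in> T \<and> (\<forall>b\<in>T. h a = h b)"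
    by (intro exI[of _ ?V]) simp
qed auto

theorem corollary4p8:
  fixes M :: "('i, 'm::{t2_space, second_countable_topology}, real^'n) rmfd"
    and I :: "real set" and f :: "real \<Rightarrow> real"
    and \<Sigma> :: "('k, 's::{t2_space, second_countable_topology}, real^'n) rmfd"
    and x :: "'s \<Rightarrow> real \<times> 'm"
    and N :: "'i \<Rightarrow> 's \<Rightarrow> real \<times> (real^'n)"
  assumes dim: "CARD('n) \<ge> 2"
    and M: "riemannian_manifold M" "connected (carrier M)" "oriented M"
    and I: "is_interval I"
    and f: "smooth_on I f" "\<forall>t\<in>I. f t > 0"
    and H_ge_1: "\<forall>t\<in>I. warp_H I f t \<ge> 1"
    and Sigma: "riemannian_manifold \<Sigma>" "connected (carrier \<Sigma>)"
    and immersion: "isometric_immersion \<Sigma> (warped_product I f M) x"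
    and normal: "unit_normal_field \<Sigma> (warped_product I f M) x N"
    and complete: "complete_riemannian \<Sigma>"
    and noncompact: "\<not> compact (carrier \<Sigma>)"
    and helix: "helix_type \<Sigma> (warped_product I f M) x N"
    and slab: "in_slab \<Sigma> I M x"
    and growth: "polynomial_volume_growth \<Sigma>"
    and mean_curv: "\<forall>p\<in>carrier \<Sigma>. (mean_curvature \<Sigma> (warped_product I f M) x N p)\<^sup>2 \<le> 1"
  shows "is_slice \<Sigma> I M x"
proof -
  let ?W = "warped_product I f M"
  note sM = riemannian_smooth_manifold[OF M(1)] and sS = riemannian_smooth_manifold[OF Sigma(1)]
  define h where "h p = fst (x p)" for p
  define y where "y p = snd (x p)" for p
  have x: "smooth_map \<Sigma> ?W x" using immersion by (simp add: isometric_immersion_def)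
  have cont: "continuous_on (carrier \<Sigma>) h" "continuous_on (carrier \<Sigma>) y"
    using x unfolding h_def y_def smooth_map_def by (auto intro!: continuous_intros)
  have x_in: "x p \<in> I \<times> carrier M" if "p \<in> carrier \<Sigma>" for p
    using x that by (auto simp: smooth_map_def warped_product_simps)
  have h_in: "h p \<in> I" and y_in: "y p \<in> carrier M" if "p \<in> carrier \<Sigma>" for p
    using x_in[OF that] by (auto simp: h_def y_def)
  obtain \<Theta> where \<Theta>: "\<And>p. p \<in> carrier \<Sigma> \<Longrightarrow> angle_function ?W x N p = \<Theta>"
    using helix by (auto simp: helix_type_def constant_on_def)
  let ?D = "\<lambda>i j p. differential \<Sigma> ?W x i j p"
  have iso: "inj (?D i j p)"
    "chart_metric \<Sigma> i p v w = chart_metric ?W j (x p) (?D i j p v) (?D i j p w)"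
    if "p \<in> chart_dom \<Sigma> i" "x p \<in> chart_dom ?W j" for i j p v w
    using immersion that unfolding isometric_immersion_def by auto
  have nor: "chart_metric ?W j (x p) (N j p) (N j p) = 1"
    "chart_metric ?W j (x p) (N j p) (?D i j p v) = 0"
    if "p \<in> chart_dom \<Sigma> i" "x p \<in> chart_dom ?W j" for i j p v
    using normal that unfolding unit_normal_field_def by auto
  have vert: "\<Theta>\<^sup>2 \<le> 1"
    "\<Theta>\<^sup>2 = 1 \<Longrightarrow> fst (?D i (chart_at ?W (x p)) p v) = 0"
    "\<exists>v. fst (?D i (chart_at ?W (x p)) p v) = 1 - \<Theta>\<^sup>2 \<and> chart_metric \<Sigma> i p v v = 1 - \<Theta>\<^sup>2"
    and at: "x p \<in> chart_dom ?W (chart_at ?W (x p))"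
    if p: "p \<in> chart_dom \<Sigma> i" for i p v
  proof -
    define j where "j = chart_at ?W (x p)"
    have pS: "p \<in> carrier \<Sigma>" using p unfolding carrier_def by blast
    have "x p \<in> carrier ?W" using x_in[OF pS] by (simp add: warped_product_simps)
    then have j: "x p \<in> chart_dom ?W j" unfolding j_def by (rule chart_at_dom)
    then show "x p \<in> chart_dom ?W (chart_at ?W (x p))" by (simp add: j_def)
    have pos: "f (fst (x p)) > 0" and snd: "snd (x p) \<in> chart_dom M j"
      using f(2) h_in[OF pS] j by (auto simp: h_def warped_product_simps)
    note met = warped_product_metric[where I = I and f = f and z = "x p", OF M(1) pos snd]
    have dt: "chart_metric ?W j (x p) (1, 0) w = fst w" for w
      using bilinear_lzero[OF chart_metric_bilinear[OF M(1) snd]] by (simp add: warped_product_simps)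
    have ang: "chart_metric ?W j (x p) (N j p) (1, 0) = \<Theta>"
      using \<Theta>[OF pS] by (simp add: angle_function_def j_def Let_def)
    note V = vertical_field_of_hypersurface[OF met smooth_map_differential(3)[OF sS sM x p j]
        iso(1)[OF p j] nor(1)[OF p j] nor(2)[OF p j] dt ang]
    show "\<Theta>\<^sup>2 \<le> 1" by (rule V(1))
    show "\<Theta>\<^sup>2 = 1 \<Longrightarrow> fst (?D i (chart_at ?W (x p)) p v) = 0"
      using V(2) unfolding j_def by blast
    show "\<exists>v. fst (?D i (chart_at ?W (x p)) p v) = 1 - \<Theta>\<^sup>2 \<and> chart_metric \<Sigma> i p v v = 1 - \<Theta>\<^sup>2"
      using V(3) unfolding iso(2)[OF p j] unfolding j_def .
  qed
  have "carrier \<Sigma> \<noteq> {}" using noncompact by auto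
  then obtain p0 where p0: "p0 \<in> carrier \<Sigma>" by blast
  then obtain i0 where i0: "p0 \<in> chart_dom \<Sigma> i0" by (auto simp: carrier_def)
  obtain t1 t2 where slab': "x ` carrier \<Sigma> \<subseteq> {t1..t2} \<times> carrier M"
    using slab by (auto simp: in_slab_def)
  have h_le: "h p \<le> t2" if "p \<in> carrier \<Sigma>" for p
    using slab' that by (auto simp: h_def)
  \<comment> \<open>Otherwise \<open>h\<close> would be a bounded function whose gradient has constant length \<open>s > 0\<close>.\<close>
  have \<Theta>1: "\<Theta>\<^sup>2 = 1"
  proof (rule ccontr)
    assume "\<Theta>\<^sup>2 \<noteq> 1"
    then have less: "\<Theta>\<^sup>2 < 1" using vert(1)[OF i0] by simp
    define s where "s = sqrt (1 - \<Theta>\<^sup>2)"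
    have s: "s > 0" "1 - \<Theta>\<^sup>2 = s\<^sup>2" using less by (simp_all add: s_def)
    have lsc: "closedin (top_of_set (carrier \<Sigma>)) {p \<in> carrier \<Sigma>. - h p \<le> a}" for a
    proof -
      have "closedin (top_of_set (carrier \<Sigma>)) (carrier \<Sigma> \<inter> h -` {- a..})"
        using cont(1) by (intro continuous_closedin_preimage) auto
      moreover have "{p \<in> carrier \<Sigma>. - h p \<le> a} = carrier \<Sigma> \<inter> h -` {- a..}" by auto
      ultimately show ?thesis by simp
    qed
    have bdd: "- t2 \<le> - h p" if "p \<in> carrier \<Sigma>" for p using h_le[OF that] by simp
    have "s / 2 > 0" using s(1) by simp
    show False
    proof (rule almost_critical_point[OF Sigma complete \<open>s / 2 > 0\<close> p0 bdd lsc])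
      fix p assume p: "p \<in> carrier \<Sigma>"
        and crit: "\<And>i v D. p \<in> chart_dom \<Sigma> i \<Longrightarrow>
          ((\<lambda>t. - h (chart_inv \<Sigma> i (chart_map \<Sigma> i p + t *\<^sub>R v))) has_real_derivative D) (at 0) \<Longrightarrow>
          - (s / 2) * tangent_norm \<Sigma> i p v \<le> D"
      obtain i where i: "p \<in> chart_dom \<Sigma> i" using p by (auto simp: carrier_def)
      define j where "j = chart_at ?W (x p)"
      obtain v where v: "fst (?D i j p v) = s\<^sup>2" "chart_metric \<Sigma> i p v v = s\<^sup>2"
        using vert(3)[OF i] unfolding s(2) j_def by blast
      let ?u = "chart_map \<Sigma> i p"
      note diff = smooth_map_differential[OF sS sM x i at[OF i], folded j_def]
      have "((\<lambda>t::real. ?u + t *\<^sub>R v) has_derivative (\<lambda>k. k *\<^sub>R v)) (at 0)"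
        by (auto intro!: derivative_eq_intros)
      moreover have "((\<lambda>u. fst (x (chart_inv \<Sigma> i u))) has_derivative (\<lambda>v. fst (?D i j p v)))
          (at (?u + 0 *\<^sub>R v))"
        using diff(1) by simp
      ultimately have "((\<lambda>t. h (chart_inv \<Sigma> i (?u + t *\<^sub>R v))) has_derivative
          (\<lambda>k. fst (?D i j p (k *\<^sub>R v)))) (at 0)"
        unfolding h_def by (rule has_derivative_compose)
      then have "((\<lambda>t. h (chart_inv \<Sigma> i (?u + t *\<^sub>R v))) has_real_derivative s\<^sup>2) (at 0)"
        by (rule has_derivative_imp_has_field_derivative) (simp add: linear_scale[OF diff(3)] v(1))
      then have "((\<lambda>t. - h (chart_inv \<Sigma> i (?u + t *\<^sub>R v))) has_real_derivative - s\<^sup>2) (at 0)"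
        by (rule DERIV_minus)
      then have "- (s / 2) * tangent_norm \<Sigma> i p v \<le> - s\<^sup>2" by (rule crit[OF i])
      moreover have "tangent_norm \<Sigma> i p v = s" using v(2) s(1) by (simp add: tangent_norm_def)
      ultimately have "s * s \<le> s * s / 2" by (simp add: power2_eq_square)
      then show False using s(1) by simp
    qed
  qed
  define t0 where "t0 = h p0"
  have t0: "t0 \<in> I" "f t0 > 0" using h_in[OF p0] f(2) by (auto simp: t0_def)
  have h_t0: "h p = t0" if "p \<in> carrier \<Sigma>" for p
    unfolding t0_def
  proof (rule constant_on_if_zero_chart_derivative[OF sS Sigma(2) _ that p0])
    fix i q assume q: "q \<in> chart_dom \<Sigma> i"
    then show "((\<lambda>u. h (chart_inv \<Sigma> i u)) has_derivative (\<lambda>v. 0)) (at (chart_map \<Sigma> i q))"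
      using smooth_map_differential(1)[OF sS sM x q at[OF q]] vert(2)[OF q \<Theta>1]
      by (simp add: h_def)
  qed
  have "y ` carrier \<Sigma> = carrier M"
  proof (rule complete_local_homothety_surj[OF Sigma complete \<open>carrier \<Sigma> \<noteq> {}\<close> M(1,2) cont(2) _ t0(2)])
    show "y ` carrier \<Sigma> \<subseteq> carrier M" using y_in by blast
    fix i j p assume p: "p \<in> chart_dom \<Sigma> i" and yj: "y p \<in> chart_dom M j"
    have pS: "p \<in> carrier \<Sigma>" using p unfolding carrier_def by blast
    have xj: "x p \<in> chart_dom ?W j"
      using yj h_in[OF pS] by (simp add: warped_product_simps mem_Times_iff h_def y_def)
    define D where "D = ?D i j p"
    note diff = smooth_map_differential[OF sS sM x p xj, folded D_def]
    have "((\<lambda>u. h (chart_inv \<Sigma> i u)) has_derivative (\<lambda>v. 0)) (at (chart_map \<Sigma> i p))"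
      using smooth_map_differential(1)[OF sS sM x p at[OF p]] vert(2)[OF p \<Theta>1]
      by (simp add: h_def)
    then have "(\<lambda>v. fst (D v)) = (\<lambda>v. 0)"
      using has_derivative_unique[OF diff(1)] unfolding h_def by blast
    then have fst0: "fst (D v) = 0" for v by metis
    have inj: "inj (\<lambda>v. snd (D v))"
    proof (rule injI)
      fix v w assume "snd (D v) = snd (D w)"
      then have "D v = D w" using fst0 by (simp add: prod_eq_iff)
      then show "v = w" using iso(1)[OF p xj] unfolding D_def by (rule injD[rotated])
    qed
    moreover have "linear (\<lambda>v. snd (D v))" by (rule has_derivative_linear[OF diff(2)])
    ultimately have "surj (\<lambda>v. snd (D v))" using linear_injective_imp_surjective by blast
    moreover have "tangent_norm \<Sigma> i p v = f t0 * tangent_norm M j (y p) (snd (D v))" for v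
      using iso(2)[OF p xj, of v v] fst0[of v] h_t0[OF pS] t0(2)
      by (simp add: tangent_norm_def warped_product_simps D_def h_def y_def real_sqrt_mult)
    ultimately show "\<exists>D. ((chart_map M j \<circ> y \<circ> chart_inv \<Sigma> i) has_derivative D) (at (chart_map \<Sigma> i p)) \<and>
        surj D \<and> (\<forall>v. tangent_norm \<Sigma> i p v = f t0 * tangent_norm M j (y p) (D v))"
      using diff(2) unfolding y_def by (intro exI[of _ "\<lambda>v. snd (D v)"]) simp
  qed
  moreover have "x ` carrier \<Sigma> = {t0} \<times> y ` carrier \<Sigma>"
  proof -
    have "x p = (t0, y p)" if "p \<in> carrier \<Sigma>" for p
      using h_t0[OF that] by (simp add: h_def y_def prod_eq_iff)
    then have "x ` carrier \<Sigma> = (\<lambda>p. (t0, y p)) ` carrier \<Sigma>" by (intro image_cong) auto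
    then show ?thesis by auto
  qed
  ultimately show ?thesis
    using t0(1) unfolding is_slice_def by auto
qed

end
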